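(* Consider the centralized selection model described in the context with $n_1=n_2=K$ (so $n=2K$), latent utilities drawn i.i.d. from the uniform distribution on $[0,1]$, and preference lists drawn i.i.d. from an arbitrary distribution $\mathcal L$ over rankings of the $p$ institutions. Then, for every bias parameter $\beta\in(0,1]$, $$\mathscr{P}(\mathcal{A}_{\rm st}) \le \beta + O\!\left(\frac{p\sqrt{\log n}}{\sqrt{n}}\right),\qquad \mathscr{R}(\mathcal{A}_{\rm st}) = \beta \pm O\!\left(\frac{\sqrt{\log n}}{\sqrt{n}}\right),$$ $$\mathscr{U}(\mathcal{A}_{\rm st}) = \frac{2}{3} + \frac{4\beta}{3(\beta+1)^2} \pm O\!\left(\frac{\sqrt{\log n}}{\sqrt{n}}\right),$$ where the implicit constants in the $O(\cdot)$ terms are absolute.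
   Context: Model: there are $n$ candidates and $p$ institutions; institution $\ell\in[p]$ has capacity $k_\ell\in\mathbb{Z}_{\ge0}$ and $K=\sum_{\ell} k_\ell\le n$. The candidates are partitioned into an advantaged group $G_1$ and a disadvantaged group $G_2$, with $n_j=|G_j|$. Each candidate $i$ has a latent utility $u_i\ge 0$ (drawn i.i.d. from a distribution $\mathcal D$) and a preference list $\sigma_i$, a ranking of $[p]$ (drawn i.i.d. from a distribution $\mathcal L$, independently of utilities). For an unknown bias parameter $\beta\in(0,1]$ the estimated utilities are $\hat u_i=u_i$ for $i\in G_1$ and $\hat u_i=\beta u_i$ for $i\in G_2$. An assignment is a partial function $M:[n]\to[p]$ with $|M^{-1}(\ell)|\le k_\ell$ for all $\ell$. Algorithm $\mathcal A_{\rm st}$ (given $\hat u,\sigma$): consider candidates in decreasing order of $\hat u_i$ and assign each to its most preferred institution (according to $\sigma_i$) that still has a vacant slot, until all slots are full. Metrics for an algorithm $\mathcal A$ that outputs $M$ from $(\hat u,\sigma)$, expectations over $u\sim\mathcal D^n,\sigma\sim\mathcal L^n$: $\mathscr U(\mathcal A)=\mathbb E\big[\sum_{i\in M^{-1}([p])}u_i \,/\, \mathsf U^\star(u)\big]$, where $\mathsf U^\star(u)$ is the sum of the $K$ largest latent utilities; $\mathscr R(\mathcal A)=\mathbb E[\min_j\rho_j/\max_j\rho_j]$ where $\rho_j$ is the fraction of candidates of $G_j$ assigned to some institution; $\mathscr P(\mathcal A)=\mathbb E[\min_j\pi_j/\max_j\pi_j]$ where $\pi_j$ is the fraction of candidates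 of $G_j$ assigned to their first-ranked institution.
   Formalization: The bound on P is proved when every ranking in the support of L has a first-ranked institution with at least one slot (automatic if all capacities are ≥ 1); with zero-capacity institutions ranked first the stated bound on P can fail. *)

theory Defs
  imports "HOL-Probability.Probability" "HOL-Combinatorics.Multiset_Permutations"
begin

text \<open>
  Candidates are \<open>{..<n}\<close> and institutions are \<open>{..<p}\<close>. A ranking of the institutions is a list
  in \<open>permutations_of_set {..<p}\<close>, most preferred institution first.
\<close>

definition est_utility :: "nat set \<Rightarrow> real \<Rightarrow> (nat \<Rightarrow> real) \<Rightarrow> nat \<Rightarrow> real" where
  "est_utility G2 \<beta> u i = (if i \<in> G2 then \<beta> * u i else u i)"

text \<open>
  The first argument of \<open>serial_assign\<close> gives the numbers of slots that are still vacant. When all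
  slots are full, \<open>find\<close> returns \<open>None\<close> and the remaining candidates stay unassigned.
\<close>

primrec serial_assign ::
  "(nat \<Rightarrow> nat) \<Rightarrow> (nat \<Rightarrow> nat list) \<Rightarrow> nat list \<Rightarrow> (nat \<rightharpoonup> nat)" where
  "serial_assign c \<sigma> [] = Map.empty"
| "serial_assign c \<sigma> (i # is) =
    (case find (\<lambda>l. 0 < c l) (\<sigma> i) of
       None \<Rightarrow> serial_assign c \<sigma> is
     | Some l \<Rightarrow> (serial_assign (c(l := c l - 1)) \<sigma> is)(i \<mapsto> l))"

text \<open>
  Equal estimated utilities are ordered by index, since \<open>sort_key\<close> is stable. For continuously
  distributed utilities and \<open>\<beta> > 0\<close>, ties have probability 0.
\<close>

definition A_st ::
  "nat \<Rightarrow> (nat \<Rightarrow> nat) \<Rightarrow> (nat \<Rightarrow> real) \<Rightarrow> (nat \<Rightarrow> nat list) \<Rightarrow> (nat \<rightharpoonup> nat)" where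
  "A_st n k uhat \<sigma> = serial_assign k \<sigma> (sort_key (\<lambda>i. - uhat i) [0..<n])"

definition opt_utility :: "nat \<Rightarrow> nat \<Rightarrow> (nat \<Rightarrow> real) \<Rightarrow> real" where
  "opt_utility n K u = sum_list (take K (rev (sort (map u [0..<n]))))"

definition assigned_frac :: "(nat \<rightharpoonup> nat) \<Rightarrow> nat set \<Rightarrow> real" where
  "assigned_frac M G = real (card {i \<in> G. M i \<noteq> None}) / real (card G)"

definition first_choice_frac :: "(nat \<Rightarrow> nat list) \<Rightarrow> (nat \<rightharpoonup> nat) \<Rightarrow> nat set \<Rightarrow> real" where
  "first_choice_frac \<sigma> M G = real (card {i \<in> G. M i = Some (hd (\<sigma> i))}) / real (card G)"

text \<open>
  Here \<open>0 / 0 = 0\<close>. For \<open>A_st\<close> the value of this convention is immaterial whenever some candidate is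
  assigned (for \<open>assigned_frac\<close>), respectively whenever the candidate considered first has a
  first-ranked institution with a slot (for \<open>first_choice_frac\<close>).
\<close>

definition min_max_ratio :: "real \<Rightarrow> real \<Rightarrow> real" where
  "min_max_ratio x y = min x y / max x y"

text \<open>The joint law of utilities and preferences. The list \<open>[]\<close> is a dummy value outside \<open>{..<n}\<close>.\<close>

definition profile_measure ::
  "nat \<Rightarrow> real measure \<Rightarrow> nat list pmf \<Rightarrow> ((nat \<Rightarrow> real) \<times> (nat \<Rightarrow> nat list)) measure" where
  "profile_measure n D L =
     (\<Pi>\<^sub>M i\<in>{..<n}. D) \<Otimes>\<^sub>M measure_pmf (Pi_pmf {..<n} [] (\<lambda>_. L))"

type_synonym algorithm = "(nat \<Rightarrow> real) \<Rightarrow> (nat \<Rightarrow> nat list) \<Rightarrow> (nat \<rightharpoonup> nat)"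

definition utility_metric ::
  "nat \<Rightarrow> nat \<Rightarrow> nat set \<Rightarrow> real \<Rightarrow> real measure \<Rightarrow> nat list pmf \<Rightarrow> algorithm \<Rightarrow> real" where
  "utility_metric n K G2 \<beta> D L A =
     (\<integral>(u, \<sigma>). (\<Sum>i\<in>dom (A (est_utility G2 \<beta> u) \<sigma>). u i) / opt_utility n K u
        \<partial>profile_measure n D L)"

definition representation_metric ::
  "nat \<Rightarrow> nat set \<Rightarrow> nat set \<Rightarrow> real \<Rightarrow> real measure \<Rightarrow> nat list pmf \<Rightarrow> algorithm \<Rightarrow> real" where
  "representation_metric n G1 G2 \<beta> D L A =
     (\<integral>(u, \<sigma>). (let M = A (est_utility G2 \<beta> u) \<sigma>
                in min_max_ratio (assigned_frac M G1) (assigned_frac M G2))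
        \<partial>profile_measure n D L)"

definition preference_metric ::
  "nat \<Rightarrow> nat set \<Rightarrow> nat set \<Rightarrow> real \<Rightarrow> real measure \<Rightarrow> nat list pmf \<Rightarrow> algorithm \<Rightarrow> real" where
  "preference_metric n G1 G2 \<beta> D L A =
     (\<integral>(u, \<sigma>). (let M = A (est_utility G2 \<beta> u) \<sigma>
                in min_max_ratio (first_choice_frac \<sigma> M G1) (first_choice_frac \<sigma> M G2))
        \<partial>profile_measure n D L)"

text \<open>
  No candidate's first-ranked institution is one without any slots; this holds in particular if all
  capacities are positive. Without such a condition the expected number of candidates who get their
  first choice can stay bounded as \<open>n\<close> grows, and the bound \<open>\<beta> + o(1)\<close> on the preference metric
  fails: take \<open>p = 2\<close>, \<open>k 0 = 0\<close>, \<open>k 1 = K\<close>, \<open>\<beta> = 1/10\<close>, and let \<open>L\<close> give \<open>[1, 0]\<close> probability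
  \<open>11 / n\<close> and \<open>[0, 1]\<close> the rest. The numbers of assigned first choices in \<open>G1\<close> and \<open>G2\<close> are then
  asymptotically independent Poisson with means \<open>5\<close> and \<open>1/2\<close>, and the metric tends to about \<open>0.12\<close>.
\<close>

definition first_choices_have_slots :: "(nat \<Rightarrow> nat) \<Rightarrow> nat list pmf \<Rightarrow> bool" where
  "first_choices_have_slots k L \<longleftrightarrow> (\<forall>r\<in>set_pmf L. 0 < k (hd r))"

end

theory Submission
  imports Defs
begin

text \<open>
  The assigned candidates are the \<open>K\<close> highest estimated utilities, whatever the preferences. They
  differ from the candidates above the cutoff \<open>\<beta> / (1 + \<beta>)\<close>, which is chosen so that \<open>K\<close> of them
  are expected, by as many candidates as the number above the cutoff differs from \<open>K\<close>. A variance
  bound makes this difference \<open>O(sqrt n)\<close> in mean, which gives the representation and the utility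
  metric.

  For the preference metric let \<open>X\<close> and \<open>Y\<close> be the numbers of first choices assigned in \<open>G2\<close> and
  \<open>G1\<close>. They may be small, so concentration is of no use; instead \<open>E[X / Y]\<close> is bounded by the
  expectation of the same ratio for the numbers of assigned candidates. Write \<open>X / Y\<close> as a sum over
  \<open>i \<in> G2\<close>. Exchanging the estimated utilities of \<open>i\<close> and of a \<open>j \<in> G1\<close> with \<open>u j \<le> \<beta>\<close> preserves
  their law, so the contribution of \<open>i\<close> may be averaged over \<open>i\<close> and all such \<open>j\<close>. These candidates
  come after the other members of \<open>G1\<close> in the order, and the probability that a first choice is
  still available decreases along the order; hence their expected share among the first choices
  is at most their share among the assigned candidates. Exchanging back gives the claim.
\<close>

subsection \<open>Serial assignment\<close>

text \<open>Members of \<open>G2\<close> and members of \<open>G1\<close> below \<beta> are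
  comparable because a uniform variable conditioned to be at most \<beta> has the law of \<beta>
  times a uniform variable. The bias thus acts only through the members of \<open>G1\<close> above
  \<beta>, who almost surely precede all of \<open>G2\<close>. Two obstacles shape the preference
  argument. The ratio \<open>X / Y\<close> is not symmetric in \<open>i\<close> and
  \<open>j\<close>, since \<open>i\<close> counts above and \<open>j\<close> below the line; making
  it symmetric without changing its value takes a leader of the order that surely counts in
  \<open>Y\<close> and that no exchange moves. Such a leader is missing with probability \<beta> to
  the power \<open>K\<close>, which is small unless \<beta> is near 1, and there the trivial bound 1
  suffices. Moreover, if \<open>a\<close> members of \<open>G1\<close> are assigned, the comparison
  ratio is \<open>(K - a) / a\<close>, which is unbounded for small \<open>a\<close>; hence the
  restriction to \<open>a\<close> at least \<open>K / 4\<close>, while \<open>a\<close> is typically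
  about \<open>K / (1 + \<beta>)\<close>, at least \<open>K / 2\<close>. All errors are of order
  \<open>1 / sqrt n\<close>. The logarithm and the factor \<open>p\<close> come in only at the end,
  as quantities bounded below by positive constants.\<close>

definition fill_slot :: "(nat \<Rightarrow> nat) \<Rightarrow> nat list \<Rightarrow> nat \<Rightarrow> nat" where
  "fill_slot c r = (case find (\<lambda>l. 0 < c l) r of None \<Rightarrow> c | Some l \<Rightarrow> c(l := c l - 1))"

text \<open>The candidates with a granted first choice: \<open>find\<close> returns the head of a
  ranking iff the head has a vacant slot. The recursion reveals one ranking at a time, as the
  inductions over random preferences require.\<close>

primrec receivers :: "(nat \<Rightarrow> nat) \<Rightarrow> (nat \<Rightarrow> nat list) \<Rightarrow> nat list \<Rightarrow> nat set" where
  "receivers c \<sigma> [] = {}"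
| "receivers c \<sigma> (i # is) =
    (if 0 < c (hd (\<sigma> i)) then {i} else {}) \<union> receivers (fill_slot c (\<sigma> i)) \<sigma> is"

lemma serial_assign_Cons_fill:
  "serial_assign c \<sigma> (i # is) =
    (case find (\<lambda>l. 0 < c l) (\<sigma> i) of
       None \<Rightarrow> serial_assign (fill_slot c (\<sigma> i)) \<sigma> is
     | Some l \<Rightarrow> (serial_assign (fill_slot c (\<sigma> i)) \<sigma> is)(i \<mapsto> l))"
  by (simp add: fill_slot_def split: option.splits)

lemma fill_slot_le: "fill_slot c r l \<le> c l"
  by (auto simp: fill_slot_def split: option.splits)

lemma fill_slot_full:
  assumes "r \<in> permutations_of_set {..<p}" "(\<Sum>l<p. c l) = 0"
  shows "find (\<lambda>l. 0 < c l) r = None" "fill_slot c r = c"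
proof -
  have "set r = {..<p}" using assms(1) by (simp add: permutations_of_set_def)
  then show "find (\<lambda>l. 0 < c l) r = None"
    using assms(2) by (auto simp: find_None_iff)
  then show "fill_slot c r = c" by (simp add: fill_slot_def)
qed

lemma find_slot:
  fixes c :: "nat \<Rightarrow> nat"
  assumes "r \<in> permutations_of_set {..<p}" "0 < (\<Sum>l<p. c l)"
  obtains l where "find (\<lambda>l. 0 < c l) r = Some l" "l < p" "0 < c l"
proof -
  have r: "set r = {..<p}" using assms(1) by (simp add: permutations_of_set_def)
  have "\<exists>l\<in>{..<p}. c l \<noteq> 0"
    using sum.not_neutral_contains_not_neutral[OF gr_implies_not0[OF assms(2)]] by blast
  then obtain l0 where "l0 \<in> set r" "0 < c l0" using r by auto
  then have "\<exists>l. find (\<lambda>l. 0 < c l) r = Some l" by (induction r) auto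
  then obtain l where l: "find (\<lambda>l. 0 < c l) r = Some l" ..
  then have "0 < c l \<and> l \<in> set r" by (metis find_Some_iff nth_mem)
  with l r that show ?thesis by auto
qed

text \<open>A complete ranking finds a vacant slot whenever there is one, so every candidate uses up
  exactly one, whatever it prefers. Truncated subtraction covers the case that all slots are
  full.\<close>

lemma sum_fill_slot:
  assumes "r \<in> permutations_of_set {..<p}"
  shows "(\<Sum>l<p. fill_slot c r l) = (\<Sum>l<p. c l) - 1"
proof (cases "(\<Sum>l<p. c l) = 0")
  case True
  then show ?thesis using fill_slot_full[OF assms True] by simp
next
  case False
  then obtain l where l: "find (\<lambda>l. 0 < c l) r = Some l" "l < p" "0 < c l"
    using find_slot[OF assms] by blast
  have "(\<Sum>l<p. c l) = c l + (\<Sum>l\<in>{..<p}-{l}. c l)"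
    using l by (intro sum.remove) auto
  moreover have "(\<Sum>l<p. fill_slot c r l) = (c l - 1) + (\<Sum>l\<in>{..<p}-{l}. c l)"
    using l by (subst sum.remove[of _ l]) (auto simp: fill_slot_def intro!: sum.cong)
  ultimately show ?thesis using l by simp
qed

lemma dom_serial_assign_subset: "dom (serial_assign c \<sigma> xs) \<subseteq> set xs"
  by (induction xs arbitrary: c) (auto split: option.splits if_splits)

lemma dom_serial_assign:
  assumes "\<And>i. i \<in> set xs \<Longrightarrow> \<sigma> i \<in> permutations_of_set {..<p}"
  shows "dom (serial_assign c \<sigma> xs) = set (take (\<Sum>l<p. c l) xs)"
  using assms
proof (induction xs arbitrary: c)
  case (Cons i xs)
  have r: "\<sigma> i \<in> permutations_of_set {..<p}" using Cons.prems by simp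
  have IH: "dom (serial_assign (fill_slot c (\<sigma> i)) \<sigma> xs) = set (take ((\<Sum>l<p. c l) - 1) xs)"
    using Cons.IH[of "fill_slot c (\<sigma> i)"] Cons.prems sum_fill_slot[OF r, of c] by simp
  show ?case
  proof (cases "(\<Sum>l<p. c l) = 0")
    case True
    then show ?thesis using fill_slot_full[OF r True] IH
      by (simp add: serial_assign_Cons_fill del: serial_assign.simps(2) dom_eq_empty_conv)
  next
    case False
    then obtain l where l: "find (\<lambda>l. 0 < c l) (\<sigma> i) = Some l"
      using find_slot[OF r] by blast
    obtain m where "(\<Sum>l<p. c l) = Suc m" using False by (metis not0_implies_Suc)
    then show ?thesis using l IH
      by (simp add: serial_assign_Cons_fill del: serial_assign.simps(2) fun_upd_apply)
  qed
qed simp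

lemma receivers_subset: "receivers c \<sigma> xs \<subseteq> set xs"
  by (induction xs arbitrary: c) auto

lemma finite_receivers [simp]: "finite (receivers c \<sigma> xs)"
  by (rule finite_subset[OF receivers_subset finite_set])

lemma receivers_eq:
  assumes "distinct xs" "\<And>i. i \<in> set xs \<Longrightarrow> \<sigma> i \<noteq> []"
  shows "receivers c \<sigma> xs = {i. serial_assign c \<sigma> xs i = Some (hd (\<sigma> i))}"
  using assms
proof (induction xs arbitrary: c)
  case (Cons i xs)
  obtain a r where ar: "\<sigma> i = a # r" using Cons.prems(2)[of i] by (cases "\<sigma> i") auto
  have None: "serial_assign c' \<sigma> xs i = None" for c'
    using dom_serial_assign_subset[of c' \<sigma> xs] Cons.prems(1) by auto
  have IH: "receivers (fill_slot c (\<sigma> i)) \<sigma> xs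
      = {j. serial_assign (fill_slot c (\<sigma> i)) \<sigma> xs j = Some (hd (\<sigma> j))}"
    using Cons by simp
  have iff: "(find (\<lambda>l. 0 < c l) (\<sigma> i) = Some a) \<longleftrightarrow> 0 < c a"
    using ar by (auto simp: find_Some_iff)
  have hd: "hd (\<sigma> i) = a" using ar by simp
  show ?case
    unfolding serial_assign_Cons_fill receivers.simps IH hd
    using iff None hd
    by (auto split: option.splits if_splits simp del: serial_assign.simps)
qed simp

lemma receivers_subset_take:
  assumes "\<And>i. i \<in> set xs \<Longrightarrow> \<sigma> i \<in> permutations_of_set {..<p}"
    "distinct xs" "0 < p"
  shows "receivers c \<sigma> xs \<subseteq> set (take (\<Sum>l<p. c l) xs)"
proof -
  have ne: "\<sigma> i \<noteq> []" if "i \<in> set xs" for i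
    using permutations_of_setD(1)[OF assms(1)[OF that]] \<open>0 < p\<close> by (metis empty_iff lessThan_iff list.set(1))
  have "receivers c \<sigma> xs \<subseteq> dom (serial_assign c \<sigma> xs)"
    using receivers_eq[of xs \<sigma> c, OF assms(2) ne] by auto
  also have "dom (serial_assign c \<sigma> xs) = set (take (\<Sum>l<p. c l) xs)"
    using assms(1) by (rule dom_serial_assign)
  finally show ?thesis .
qed

text \<open>The recursion sees a candidate only through its ranking, so renaming candidates renames
  the receivers. It is applied to the transposition of the two exchanged candidates.\<close>

lemma receivers_map:
  assumes "\<And>i. \<tau> (\<tau> i) = i"
  shows "receivers c (\<lambda>i. \<sigma> (\<tau> i)) (map \<tau> xs) = \<tau> ` receivers c \<sigma> xs"
  by (induction xs arbitrary: c) (auto simp: assms)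

lemma receivers_cong:
  "(\<And>i. i \<in> set xs \<Longrightarrow> \<sigma> i = \<sigma>' i) \<Longrightarrow> receivers c \<sigma> xs = receivers c \<sigma>' xs"
  by (induction xs arbitrary: c) auto

text \<open>Both sets are initial segments of a list sorted by decreasing \<open>v\<close>, hence
  nested.\<close>

lemma take_sorted_threshold:
  assumes "sorted (map (\<lambda>i. - v i :: real) xs)"
  shows "set (take m xs) \<subseteq> {i \<in> set xs. t < v i} \<or> {i \<in> set xs. t < v i} \<subseteq> set (take m xs)"
  using assms
proof (induction xs arbitrary: m)
  case (Cons x xs)
  show ?case
  proof (cases m)
    case (Suc m')
    show ?thesis
    proof (cases "t < v x")
      case True
      then show ?thesis using Cons.IH[of m'] Cons.prems Suc by auto
    next
      case False
      then have "\<not> t < v i" if "i \<in> set (x # xs)" for i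
        using Cons.prems that by fastforce
      then have "{i \<in> set (x # xs). t < v i} = {}" by blast
      then show ?thesis by (metis empty_subsetI)
    qed
  qed simp
qed simp

text \<open>By nestedness the two index sets differ by exactly as many elements as their sizes do,
  and each contributes at most 1. This trades the dependent set of selected candidates for a sum of
  independent terms.\<close>

lemma sum_take_threshold_diff:
  fixes f :: "nat \<Rightarrow> real"
  assumes "sorted (map (\<lambda>i. - v i :: real) xs)" "distinct xs" "m \<le> length xs"
    and "\<And>i. i \<in> set xs \<Longrightarrow> 0 \<le> f i" "\<And>i. i \<in> set xs \<Longrightarrow> f i \<le> 1"
  shows "\<bar>(\<Sum>i\<in>set (take m xs). f i) - (\<Sum>i | i \<in> set xs \<and> t < v i. f i)\<bar>
    \<le> \<bar>real (card {i \<in> set xs. t < v i}) - real m\<bar>"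
proof -
  define A B where "A = set (take m xs)" and "B = {i \<in> set xs. t < v i}"
  have fin: "finite A" "finite B" unfolding A_def B_def by auto
  have sub: "A \<subseteq> set xs" "B \<subseteq> set xs" unfolding A_def B_def by (auto dest: in_set_takeD)
  have m: "card A = m" unfolding A_def
    using assms by (simp add: distinct_card)
  have *: "\<bar>sum f X - sum f Y\<bar> \<le> \<bar>real (card X) - real (card Y)\<bar>"
    if "X \<subseteq> Y" "finite Y" "Y \<subseteq> set xs" for X Y
  proof -
    have "sum f Y - sum f X = sum f (Y - X)" using that by (simp add: sum_diff)
    moreover have "0 \<le> sum f (Y - X)" using that assms(4) by (intro sum_nonneg) auto
    moreover have "sum f (Y - X) \<le> (\<Sum>i\<in>Y - X. 1)" using that assms(5) by (intro sum_mono) auto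
    moreover have "real (card (Y - X)) = real (card Y) - real (card X)"
      using that by (simp add: card_Diff_subset finite_subset card_mono of_nat_diff)
    ultimately show ?thesis by simp
  qed
  from take_sorted_threshold[OF assms(1), of m t] have "A \<subseteq> B \<or> B \<subseteq> A"
    unfolding A_def B_def .
  then have "\<bar>sum f A - sum f B\<bar> \<le> \<bar>real (card A) - real (card B)\<bar>"
    using *[of A B] *[of B A] fin sub by auto
  then show ?thesis unfolding A_def[symmetric] B_def[symmetric] m by simp
qed

subsection \<open>Binomial expectations\<close>

text \<open>
  \<open>bin_expect n q \<phi>\<close> is the expectation of \<open>\<phi>\<close> under the binomial distribution with parameters
  \<open>n\<close> and \<open>q\<close>.
\<close>

primrec bin_expect :: "nat \<Rightarrow> real \<Rightarrow> (nat \<Rightarrow> real) \<Rightarrow> real" where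
  "bin_expect 0 q \<phi> = \<phi> 0"
| "bin_expect (Suc n) q \<phi> = q * bin_expect n q (\<lambda>t. \<phi> (Suc t)) + (1 - q) * bin_expect n q \<phi>"

lemma bin_expect_mono_fun:
  assumes "0 \<le> q" "q \<le> 1" "\<And>t. \<phi> t \<le> \<psi> t"
  shows "bin_expect n q \<phi> \<le> bin_expect n q \<psi>"
  using assms(3)
  by (induction n arbitrary: \<phi> \<psi>) (auto intro!: add_mono mult_left_mono simp: assms)

text \<open>Raising \<open>q\<close> moves weight from the failure branch to the success branch,
  where a monotone \<phi> is at least as large.\<close>

lemma bin_expect_mono_prob:
  assumes "0 \<le> q" "q \<le> q'" "q' \<le> 1" "mono \<phi>"
  shows "bin_expect n q \<phi> \<le> bin_expect n q' \<phi>"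
  using assms(4)
proof (induction n arbitrary: \<phi>)
  case (Suc n)
  let ?\<phi> = "\<lambda>t. \<phi> (Suc t)"
  have m: "mono ?\<phi>" using Suc.prems by (auto simp: mono_def)
  have le: "bin_expect n q \<phi> \<le> bin_expect n q ?\<phi>"
    using assms Suc.prems by (intro bin_expect_mono_fun) (auto simp: mono_def)
  have "q * bin_expect n q ?\<phi> + (1 - q) * bin_expect n q \<phi>
      \<le> q' * bin_expect n q ?\<phi> + (1 - q') * bin_expect n q \<phi>"
    using mult_left_mono[OF le, of "q' - q"] assms by (simp add: algebra_simps)
  also have "\<dots> \<le> q' * bin_expect n q' ?\<phi> + (1 - q') * bin_expect n q' \<phi>"
    using Suc.IH[OF m] Suc.IH[OF Suc.prems] assms by (intro add_mono mult_left_mono) auto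
  finally show ?case by simp
qed simp

lemma bin_expect_add:
  "bin_expect n q (\<lambda>t. \<phi> t + \<psi> t) = bin_expect n q \<phi> + bin_expect n q \<psi>"
  by (induction n arbitrary: \<phi> \<psi>) (auto simp: algebra_simps)

text \<open>The size-bias identity of the binomial law: given that one of the \<open>Suc n\<close>
  trials succeeds, the other \<open>n\<close> are still binomial. It connects the two forms of
  \<open>late_bound\<close>.\<close>

lemma bin_expect_size_bias:
  "bin_expect (Suc n) q (\<lambda>t. real t * \<psi> t) = real (Suc n) * q * bin_expect n q (\<lambda>t. \<psi> (Suc t))"
proof (induction n arbitrary: \<psi>)
  case (Suc n)
  have "bin_expect (Suc (Suc n)) q (\<lambda>t. real t * \<psi> t)
      = q * bin_expect (Suc n) q (\<lambda>t. real t * \<psi> (Suc t) + \<psi> (Suc t))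
        + (1 - q) * bin_expect (Suc n) q (\<lambda>t. real t * \<psi> t)"
    by (subst bin_expect.simps(2)) (simp add: algebra_simps)
  also have "\<dots> = q * (real (Suc n) * q * bin_expect n q (\<lambda>t. \<psi> (Suc (Suc t))))
      + q * bin_expect (Suc n) q (\<lambda>t. \<psi> (Suc t))
      + (1 - q) * (real (Suc n) * q * bin_expect n q (\<lambda>t. \<psi> (Suc t)))"
    by (simp only: bin_expect_add Suc.IH[of "\<lambda>t. \<psi> (Suc t)"] Suc.IH[of \<psi>]) (simp add: algebra_simps)
  also have "\<dots> = real (Suc n) * q * bin_expect (Suc n) q (\<lambda>t. \<psi> (Suc t))
      + q * bin_expect (Suc n) q (\<lambda>t. \<psi> (Suc t))"
    by (simp add: algebra_simps)
  finally show ?case by (simp add: algebra_simps)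
qed simp

lemma bin_expect_const: "bin_expect n q (\<lambda>_. a) = a"
  by (induction n) (auto simp: algebra_simps)

text \<open>
  Suppose that \<open>n1\<close> early candidates are followed by \<open>n2\<close> late ones and that each of them receives
  its first choice with the fixed probability \<open>q\<close>. Then \<open>late_bound n1 n2 y q\<close> is the expectation
  of \<open>T2 / (y + T1 + T2)\<close>, where \<open>T1\<close> and \<open>T2\<close> count the early and the late receivers. Since it is
  monotone in \<open>q\<close>, it remains an upper bound when \<open>q\<close> decreases in the course of the assignment.
\<close>

definition late_bound :: "nat \<Rightarrow> nat \<Rightarrow> nat \<Rightarrow> real \<Rightarrow> real" where
  "late_bound n1 n2 y q = real n2 * q * bin_expect (n1 + n2 - 1) q (\<lambda>t. 1 / real (y + Suc t))"

text \<open>The \<open>n1 + n2\<close> trials are exchangeable, so the late ones carry the fraction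
  \<open>n2 / (n1 + n2)\<close> of the mean of \<open>T / (y + T)\<close>. In this form the
  integrand is monotone in the count; the defining form is the one that suits recursion on
  \<open>n1\<close>.\<close>

lemma late_bound_alt:
  "late_bound n1 n2 y q
    = real n2 / real (n1 + n2) * bin_expect (n1 + n2) q (\<lambda>t. real t * (1 / real (y + t)))"
proof (cases "n1 + n2")
  case (Suc m)
  show ?thesis
    unfolding Suc bin_expect_size_bias late_bound_def by simp
qed (simp add: late_bound_def)

lemma mono_ratio: "mono (\<lambda>t. real t * (1 / real (y + t)))"
proof (rule monoI)
  fix s t :: nat assume "s \<le> t"
  show "real s * (1 / real (y + s)) \<le> real t * (1 / real (y + t))"
  proof (cases "s = 0")
    case False
    then have "real s * real y \<le> real t * real y" using \<open>s \<le> t\<close> by (intro mult_right_mono) auto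
    then show ?thesis using False \<open>s \<le> t\<close> by (simp add: divide_simps algebra_simps)
  qed simp
qed

lemma late_bound_mono:
  assumes "0 \<le> q" "q \<le> q'" "q' \<le> 1"
  shows "late_bound n1 n2 y q \<le> late_bound n1 n2 y q'"
  unfolding late_bound_alt using assms
  by (intro mult_left_mono bin_expect_mono_prob mono_ratio) auto

lemma late_bound_le:
  assumes "0 \<le> q" "q \<le> 1"
  shows "late_bound n1 n2 y q \<le> real n2 / real (n1 + n2)"
proof -
  have "bin_expect (n1 + n2) q (\<lambda>t. real t * (1 / real (y + t))) \<le> bin_expect (n1 + n2) q (\<lambda>_. 1)"
    using assms by (intro bin_expect_mono_fun) (auto simp: divide_simps)
  then have "bin_expect (n1 + n2) q (\<lambda>t. real t * (1 / real (y + t))) \<le> 1"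
    by (simp add: bin_expect_const)
  then show ?thesis unfolding late_bound_alt by (intro mult_left_le) auto
qed

text \<open>Conditioning on the first early candidate, whose success is booked in
  \<open>y\<close>.\<close>

lemma late_bound_Suc:
  "late_bound (Suc n1) n2 y q = q * late_bound n1 n2 (Suc y) q + (1 - q) * late_bound n1 n2 y q"
\<comment> \<open>For \<open>n2 = 0\<close> the truncated \<open>n1 + n2 - 1\<close> need not grow
  with \<open>n1\<close>, but then both sides vanish.\<close>
proof (cases n2)
  case (Suc m)
  then show ?thesis by (simp add: late_bound_def algebra_simps)
qed (simp add: late_bound_def)

subsection \<open>First choices under random preferences\<close>

text \<open>Fubini for revealing one ranking; finite support turns all integrals into finite sums,
  so \<open>f\<close> may be arbitrary.\<close>

lemma expectation_Pi_pmf_insert: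
  fixes f :: "('a \<Rightarrow> 'b) \<Rightarrow> real"
  assumes "finite A" "i \<notin> A" "finite (set_pmf L)"
  shows "(\<integral>\<sigma>. f \<sigma> \<partial>measure_pmf (Pi_pmf (insert i A) d (\<lambda>_. L)))
    = (\<integral>r. (\<integral>\<sigma>. f (\<sigma>(i := r)) \<partial>measure_pmf (Pi_pmf A d (\<lambda>_. L))) \<partial>measure_pmf L)"
proof -
  let ?P = "Pi_pmf A d (\<lambda>_. L)"
  have fin: "finite (set_pmf ?P)"
    using assms by (simp add: set_Pi_pmf finite_PiE_dflt)
  have "(\<integral>\<sigma>. f \<sigma> \<partial>measure_pmf (Pi_pmf (insert i A) d (\<lambda>_. L)))
      = (\<integral>(r, \<sigma>). f (\<sigma>(i := r)) \<partial>measure_pmf (pair_pmf L ?P))"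
    using assms by (simp add: Pi_pmf_insert case_prod_unfold)
  also have "\<dots> = (\<Sum>(r, \<sigma>)\<in>set_pmf L \<times> set_pmf ?P. pmf L r * pmf ?P \<sigma> * f (\<sigma>(i := r)))"
    using assms(3) fin
    by (subst integral_measure_pmf[of "set_pmf L \<times> set_pmf ?P"]) (auto simp: pmf_pair intro!: sum.cong)
  also have "\<dots> = (\<Sum>r\<in>set_pmf L. pmf L r * (\<Sum>\<sigma>\<in>set_pmf ?P. pmf ?P \<sigma> * f (\<sigma>(i := r))))"
    by (simp add: sum.cartesian_product[symmetric] sum_distrib_left mult.assoc)
  also have "\<dots> = (\<integral>r. (\<integral>\<sigma>. f (\<sigma>(i := r)) \<partial>measure_pmf ?P) \<partial>measure_pmf L)"
    using assms(3) fin by (simp add: integral_measure_pmf[of "set_pmf L"] integral_measure_pmf[of "set_pmf ?P"])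
  finally show ?thesis .
qed

lemma expectation_if_pmf:
  fixes a b :: real
  shows "(\<integral>r. (if r \<in> S then a else b) \<partial>measure_pmf L)
    = measure_pmf.prob L S * a + (1 - measure_pmf.prob L S) * b"
proof -
  have "(\<lambda>r. if r \<in> S then a else b) = (\<lambda>r. b + (a - b) * indicator S r)"
    by (auto simp: indicator_def)
  moreover have "integrable (measure_pmf L) (\<lambda>r. (a - b) * indicator S r)"
    by (intro measure_pmf.integrable_const_bound[where B = "\<bar>a - b\<bar>"]) (auto simp: indicator_def)
  ultimately have "(\<integral>r. (if r \<in> S then a else b) \<partial>measure_pmf L)
      = b + (a - b) * measure_pmf.prob L S"
    by simp
  then show ?thesis by (simp add: algebra_simps)
qed

lemma expectation_pmf_le_if:
  fixes f :: "'a \<Rightarrow> real"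
  assumes "finite (set_pmf L)"
    and "\<And>r. r \<in> set_pmf L \<Longrightarrow> r \<in> S \<Longrightarrow> f r \<le> a"
    and "\<And>r. r \<in> set_pmf L \<Longrightarrow> r \<notin> S \<Longrightarrow> f r \<le> b"
  shows "(\<integral>r. f r \<partial>measure_pmf L) \<le> measure_pmf.prob L S * a + (1 - measure_pmf.prob L S) * b"
proof -
  have "(\<integral>r. f r \<partial>measure_pmf L) \<le> (\<integral>r. (if r \<in> S then a else b) \<partial>measure_pmf L)"
    using assms by (intro integral_mono_AE integrable_measure_pmf_finite) (auto simp: AE_measure_pmf_iff)
  then show ?thesis by (simp add: expectation_if_pmf)
qed

definition open_prob :: "nat list pmf \<Rightarrow> (nat \<Rightarrow> nat) \<Rightarrow> real" where
  "open_prob L c = measure_pmf.prob L {r. 0 < c (hd r)}"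

lemma open_prob_bounds: "0 \<le> open_prob L c" "open_prob L c \<le> 1"
  by (auto simp: open_prob_def)

text \<open>Vacancies only disappear. This is the sole reason why a late position in the order is a
  disadvantage.\<close>

lemma open_prob_fill_slot: "open_prob L (fill_slot c r) \<le> open_prob L c"
  unfolding open_prob_def
  by (intro measure_pmf.finite_measure_mono) (auto intro: less_le_trans[OF _ fill_slot_le])

lemma hd_ranking_less:
  assumes "r \<in> permutations_of_set {..<p}" "0 < p"
  shows "hd r < p"
proof -
  have r: "set r = {..<p}" by (rule permutations_of_setD(1)[OF assms(1)])
  then have "0 \<in> set r" using assms(2) by simp
  then have "hd r \<in> set r" by (cases r) auto
  then show ?thesis unfolding r by simp
qed

lemma receivers_Cons_upd:
  assumes "i \<notin> set xs"
  shows "receivers c (\<sigma>(i := r)) (i # xs)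
    = (if 0 < c (hd r) then {i} else {}) \<union> receivers (fill_slot c r) \<sigma> xs"
proof -
  have "receivers c' (\<sigma>(i := r)) xs = receivers c' \<sigma> xs" for c'
    using assms by (intro receivers_cong) auto
  then show ?thesis by simp
qed

lemma card_receivers_Cons_upd:
  assumes "i \<notin> set xs"
  shows "card (P \<inter> receivers c (\<sigma>(i := r)) (i # xs))
    = (if i \<in> P \<and> 0 < c (hd r) then 1 else 0) + card (P \<inter> receivers (fill_slot c r) \<sigma> xs)"
proof -
  have "i \<notin> receivers (fill_slot c r) \<sigma> xs" using receivers_subset assms by blast
  then show ?thesis
    unfolding receivers_Cons_upd[OF assms] by (simp add: Int_Un_distrib Int_insert_right)
qed

lemma card_Int_take_Cons:
  assumes "i \<notin> set xs"
  shows "card (P \<inter> set (take m (i # xs)))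
    = (if i \<in> P \<and> 0 < m then 1 else 0) + card (P \<inter> set (take (m - 1) xs))"
proof -
  have "i \<notin> set (take m' xs)" for m' using assms by (auto dest: in_set_takeD)
  then show ?thesis by (cases m) (auto simp: Int_insert_right)
qed

lemma open_prob_full:
  assumes "set_pmf L \<subseteq> permutations_of_set {..<p}" "(\<Sum>l<p. c l) = 0" "0 < p"
  shows "open_prob L c = 0"
proof -
  have "c (hd r) = 0" if "r \<in> set_pmf L" for r
    using hd_ranking_less[of r p] that assms by auto
  then show ?thesis by (auto simp: open_prob_def measure_pmf_zero_iff)
qed

lemma finite_rankings:
  "set_pmf L \<subseteq> permutations_of_set {..<p::nat} \<Longrightarrow> finite (set_pmf L)"
  by (rule finite_subset) auto

text \<open>Stochastic domination: given the past, each candidate receives its first choice with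
  probability at most the initial \<open>open_prob\<close>, and only as many candidates as there are
  slots can receive anything.\<close>

lemma expectation_receivers_mono:
  assumes L: "set_pmf L \<subseteq> permutations_of_set {..<p}" "0 < p"
    and "distinct xs" "mono \<phi>"
  shows "(\<integral>\<sigma>. \<phi> (card (P \<inter> receivers c \<sigma> xs)) \<partial>measure_pmf (Pi_pmf (set xs) [] (\<lambda>_. L)))
    \<le> bin_expect (card (P \<inter> set (take (\<Sum>l<p. c l) xs))) (open_prob L c) \<phi>"
  using assms(3,4)
proof (induction xs arbitrary: c \<phi>)
  case (Cons i xs)
  note fin = finite_rankings[OF L(1)]
  have i: "i \<notin> set xs" "distinct xs" using Cons.prems by auto
  define n where "n = card (P \<inter> set (take ((\<Sum>l<p. c l) - 1) xs))"
  define q where "q = open_prob L c"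
  have step: "(\<integral>\<sigma>. \<phi> (z + card (P \<inter> receivers (fill_slot c r) \<sigma> xs))
      \<partial>measure_pmf (Pi_pmf (set xs) [] (\<lambda>_. L))) \<le> bin_expect n q (\<lambda>t. \<phi> (z + t))"
    if "r \<in> set_pmf L" for r z
  proof -
    have m: "mono (\<lambda>t. \<phi> (z + t))" using Cons.prems by (auto simp: mono_def)
    have "(\<integral>\<sigma>. \<phi> (z + card (P \<inter> receivers (fill_slot c r) \<sigma> xs))
        \<partial>measure_pmf (Pi_pmf (set xs) [] (\<lambda>_. L))) \<le> bin_expect n (open_prob L (fill_slot c r)) (\<lambda>t. \<phi> (z + t))"
      using Cons.IH[OF i(2) m, of "fill_slot c r"] sum_fill_slot[of r p c] that L unfolding n_def by auto
    also have "\<dots> \<le> bin_expect n q (\<lambda>t. \<phi> (z + t))"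
      unfolding q_def by (intro bin_expect_mono_prob open_prob_bounds open_prob_fill_slot m)
    finally show ?thesis .
  qed
  have "(\<integral>\<sigma>. \<phi> (card (P \<inter> receivers c \<sigma> (i # xs))) \<partial>measure_pmf (Pi_pmf (set (i # xs)) [] (\<lambda>_. L)))
    = (\<integral>r. (\<integral>\<sigma>. \<phi> ((if i \<in> P \<and> 0 < c (hd r) then 1 else 0) + card (P \<inter> receivers (fill_slot c r) \<sigma> xs))
        \<partial>measure_pmf (Pi_pmf (set xs) [] (\<lambda>_. L))) \<partial>measure_pmf L)"
    unfolding list.set(2)
    by (subst expectation_Pi_pmf_insert[OF finite_set i(1) fin])
      (simp only: card_receivers_Cons_upd[OF i(1)])
  also have "\<dots> \<le> measure_pmf.prob L {r. 0 < c (hd r)} * bin_expect n q (\<lambda>t. \<phi> ((if i \<in> P then 1 else 0) + t))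
      + (1 - measure_pmf.prob L {r. 0 < c (hd r)}) * bin_expect n q (\<lambda>t. \<phi> (0 + t))"
    using step[of _ 1] step[of _ 0] by (intro expectation_pmf_le_if fin) auto
  also have "\<dots> = q * bin_expect n q (\<lambda>t. \<phi> ((if i \<in> P then 1 else 0) + t))
      + (1 - q) * bin_expect n q \<phi>"
    by (simp add: q_def open_prob_def)
  also have "\<dots> = bin_expect (card (P \<inter> set (take (\<Sum>l<p. c l) (i # xs)))) q \<phi>"
  proof (cases "i \<in> P \<and> 0 < (\<Sum>l<p. c l)")
    case True
    then show ?thesis by (simp add: card_Int_take_Cons[OF i(1)] n_def)
  next
    case False
    \<comment> \<open>A member of \<open>P\<close> that is not counted among the trials meets full
      institutions, so its success probability is 0.\<close>
    then have "i \<notin> P \<or> q = 0"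
      using open_prob_full[OF L(1) _ L(2), of c] by (auto simp: q_def)
    then show ?thesis using False by (auto simp: card_Int_take_Cons[OF i(1)] n_def algebra_simps)
  qed
  finally show ?case by (simp add: q_def)
qed simp

text \<open>Here \<open>y\<close> stands for the early receivers already seen. Each step conditions
  on one ranking; the recursion of \<open>late_bound\<close> keeps the old probability
  \<open>q\<close>, while the true one may have dropped, and monotonicity in \<open>q\<close>
  absorbs the difference.\<close>

lemma expectation_late_fraction:
  assumes L: "set_pmf L \<subseteq> permutations_of_set {..<p}" "0 < p"
    and "distinct xs" "sorted_wrt (\<lambda>a b. \<not> (a \<in> P2 \<and> b \<in> P1)) xs" "P1 \<inter> P2 = {}"
  shows "(\<integral>\<sigma>. real (card (P2 \<inter> receivers c \<sigma> xs))
        / real (y + card (P1 \<inter> receivers c \<sigma> xs) + card (P2 \<inter> receivers c \<sigma> xs))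
      \<partial>measure_pmf (Pi_pmf (set xs) [] (\<lambda>_. L)))
    \<le> late_bound (card (P1 \<inter> set (take (\<Sum>l<p. c l) xs))) (card (P2 \<inter> set (take (\<Sum>l<p. c l) xs))) y
         (open_prob L c)"
  using assms(3,4)
proof (induction xs arbitrary: c y)
  case (Cons i xs)
  note fin = finite_rankings[OF L(1)]
  define C where "C = (\<Sum>l<p. c l)"
  show ?case
  \<comment> \<open>Without early candidates left, the share is a monotone function of the number of
    late receivers, so a dominating binomial count bounds it.\<close>
  proof (cases "P1 \<inter> set (i # xs) = {}")
    case True
    have "P1 \<inter> receivers c \<sigma> (i # xs) = {}" for \<sigma>
      using True receivers_subset[of c \<sigma> "i # xs"] by blast
    then have 0: "card (P1 \<inter> receivers c \<sigma> (i # xs)) = 0" for \<sigma>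
      by simp
    have "P1 \<inter> set (take C (i # xs)) = {}"
      using True set_take_subset[of C "i # xs"] by blast
    then have 1: "card (P1 \<inter> set (take C (i # xs))) = 0" by simp
    have "(\<integral>\<sigma>. (\<lambda>t. real t * (1 / real (y + t))) (card (P2 \<inter> receivers c \<sigma> (i # xs)))
        \<partial>measure_pmf (Pi_pmf (set (i # xs)) [] (\<lambda>_. L)))
      \<le> bin_expect (card (P2 \<inter> set (take C (i # xs)))) (open_prob L c) (\<lambda>t. real t * (1 / real (y + t)))"
      unfolding C_def by (rule expectation_receivers_mono[OF L Cons.prems(1) mono_ratio])
    also have "\<dots> = late_bound 0 (card (P2 \<inter> set (take C (i # xs)))) y (open_prob L c)"
      by (cases "card (P2 \<inter> set (take C (i # xs))) = 0") (simp_all add: late_bound_alt)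
    finally show ?thesis unfolding C_def[symmetric] 0 1 by simp
  next
    case False
    have i: "i \<notin> set xs" "distinct xs" using Cons.prems by auto
    \<comment> \<open>Some member of \<open>P1\<close> is \<open>i\<close> itself or comes later,
      and no member of \<open>P2\<close> precedes a member of \<open>P1\<close>.\<close>
    have iP: "i \<notin> P2" using False Cons.prems(2) assms(5) by auto
    define n1 n2 where "n1 = card (P1 \<inter> set (take (C - 1) xs))"
      and "n2 = card (P2 \<inter> set (take (C - 1) xs))"
    define q where "q = open_prob L c"
    define F where "F z r \<sigma> = real (card (P2 \<inter> receivers (fill_slot c r) \<sigma> xs))
        / real (y + (z + card (P1 \<inter> receivers (fill_slot c r) \<sigma> xs))
            + card (P2 \<inter> receivers (fill_slot c r) \<sigma> xs))" for z r \<sigma>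
    have step: "(\<integral>\<sigma>. F z r \<sigma> \<partial>measure_pmf (Pi_pmf (set xs) [] (\<lambda>_. L))) \<le> late_bound n1 n2 (y + z) q"
      if "r \<in> set_pmf L" for r z
    proof -
      have "(\<integral>\<sigma>. F z r \<sigma> \<partial>measure_pmf (Pi_pmf (set xs) [] (\<lambda>_. L)))
          \<le> late_bound n1 n2 (y + z) (open_prob L (fill_slot c r))"
        using Cons.IH[OF i(2), of "fill_slot c r" "y + z"] sum_fill_slot[of r p c] that L Cons.prems
        unfolding n1_def n2_def F_def C_def by (auto simp: add.assoc)
      also have "\<dots> \<le> late_bound n1 n2 (y + z) q"
        unfolding q_def by (intro late_bound_mono open_prob_bounds open_prob_fill_slot)
      finally show ?thesis .
    qed
    have "(\<integral>\<sigma>. real (card (P2 \<inter> receivers c \<sigma> (i # xs)))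
        / real (y + card (P1 \<inter> receivers c \<sigma> (i # xs)) + card (P2 \<inter> receivers c \<sigma> (i # xs)))
      \<partial>measure_pmf (Pi_pmf (set (i # xs)) [] (\<lambda>_. L)))
      = (\<integral>r. (\<integral>\<sigma>. F (if i \<in> P1 \<and> 0 < c (hd r) then 1 else 0) r \<sigma>
          \<partial>measure_pmf (Pi_pmf (set xs) [] (\<lambda>_. L))) \<partial>measure_pmf L)"
      unfolding list.set(2) F_def
      by (subst expectation_Pi_pmf_insert[OF finite_set i(1) fin])
        (simp only: card_receivers_Cons_upd[OF i(1)], simp add: iP)
    also have "\<dots> \<le> measure_pmf.prob L {r. 0 < c (hd r)} * late_bound n1 n2 (y + (if i \<in> P1 then 1 else 0)) q
        + (1 - measure_pmf.prob L {r. 0 < c (hd r)}) * late_bound n1 n2 (y + 0) q"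
      using step[of _ 1] step[of _ 0] by (intro expectation_pmf_le_if fin) auto
    also have "\<dots> = q * late_bound n1 n2 (y + (if i \<in> P1 then 1 else 0)) q
        + (1 - q) * late_bound n1 n2 y q"
      by (simp add: q_def open_prob_def)
    also have "\<dots> = late_bound (card (P1 \<inter> set (take C (i # xs)))) (card (P2 \<inter> set (take C (i # xs)))) y q"
    proof (cases "i \<in> P1 \<and> 0 < C")
      case True
      then show ?thesis using iP
        by (simp add: card_Int_take_Cons[OF i(1)] n1_def n2_def late_bound_Suc)
    next
      case False
      then have "i \<notin> P1 \<or> q = 0"
        using open_prob_full[OF L(1) _ L(2), of c] by (auto simp: q_def C_def)
      then show ?thesis using False iP
        by (auto simp: card_Int_take_Cons[OF i(1)] n1_def n2_def algebra_simps)
    qed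
    finally show ?thesis by (simp add: q_def C_def)
  qed
qed (simp add: late_bound_def)

text \<open>The bound no longer involves \<open>L\<close>, and it involves the capacities only
  through their sum: this removes the preferences from the problem.\<close>

lemma expectation_late_fraction_le:
  assumes L: "set_pmf L \<subseteq> permutations_of_set {..<p}" "0 < p"
    and "distinct xs" "sorted_wrt (\<lambda>a b. \<not> (a \<in> P2 \<and> b \<in> P1)) xs" "P1 \<inter> P2 = {}"
  shows "(\<integral>\<sigma>. real (card (P2 \<inter> receivers c \<sigma> xs)) / real (card ((P1 \<union> P2) \<inter> receivers c \<sigma> xs))
      \<partial>measure_pmf (Pi_pmf (set xs) [] (\<lambda>_. L)))
    \<le> real (card (P2 \<inter> set (take (\<Sum>l<p. c l) xs))) / real (card ((P1 \<union> P2) \<inter> set (take (\<Sum>l<p. c l) xs)))"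
proof -
  have *: "card ((P1 \<union> P2) \<inter> S) = card (P1 \<inter> S) + card (P2 \<inter> S)" if "finite S" for S
    using that assms(5) by (subst card_Un_disjoint[symmetric]) (auto simp: Int_Un_distrib2)
  have "(\<integral>\<sigma>. real (card (P2 \<inter> receivers c \<sigma> xs)) / real (card ((P1 \<union> P2) \<inter> receivers c \<sigma> xs))
      \<partial>measure_pmf (Pi_pmf (set xs) [] (\<lambda>_. L)))
    \<le> late_bound (card (P1 \<inter> set (take (\<Sum>l<p. c l) xs))) (card (P2 \<inter> set (take (\<Sum>l<p. c l) xs))) 0
         (open_prob L c)"
    using expectation_late_fraction[OF assms, of c 0] by (simp only: * finite_receivers add_0)
  also have "\<dots> \<le> real (card (P2 \<inter> set (take (\<Sum>l<p. c l) xs)))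
      / real (card ((P1 \<union> P2) \<inter> set (take (\<Sum>l<p. c l) xs)))"
    by (simp only: * List.finite_set) (intro late_bound_le open_prob_bounds)
  finally show ?thesis .
qed

subsection \<open>Uniform utilities\<close>

definition unif01 :: "real measure" where
  "unif01 = uniform_measure lborel {0..1}"

lemma sets_unif01 [simp, measurable_cong]: "sets unif01 = sets borel"
  by (simp add: unif01_def)

lemma space_unif01 [simp]: "space unif01 = UNIV"
  by (simp add: unif01_def)

lemma prob_space_unif01: "prob_space unif01"
  unfolding unif01_def by (rule prob_space_uniform_measure) auto

lemma emeasure_unif01: "A \<in> sets borel \<Longrightarrow> emeasure unif01 A = emeasure lborel ({0..1} \<inter> A)"
  by (simp add: unif01_def divide_ennreal_def)

lemma AE_unif01: "AE x in unif01. 0 \<le> x \<and> x \<le> 1"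
  unfolding unif01_def by (rule AE_uniform_measureI) auto

lemma emeasure_unif01_singleton: "emeasure unif01 {a} = 0"
proof -
  have "emeasure lborel ({0..1} \<inter> {a}) \<le> emeasure lborel {a}"
    by (rule emeasure_mono) auto
  then show ?thesis by (simp add: emeasure_unif01)
qed

lemma measure_unif01_greaterThan:
  assumes "0 \<le> c" "c \<le> 1"
  shows "measure unif01 {c<..} = 1 - c"
proof -
  have "emeasure unif01 {c<..} = emeasure lborel {c<..1}"
    using assms by (subst emeasure_unif01, simp, intro arg_cong[where f = "emeasure lborel"]) auto
  then show ?thesis using assms by (simp add: measure_def)
qed

lemma measure_unif01_atMost:
  assumes "0 \<le> c" "c \<le> 1"
  shows "measure unif01 {..c} = c"
proof -
  have "emeasure unif01 {..c} = emeasure lborel {0..c}"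
    using assms by (subst emeasure_unif01, simp, intro arg_cong[where f = "emeasure lborel"]) auto
  then show ?thesis using assms by (simp add: measure_def)
qed

lemma integral_unif01:
  fixes f :: "real \<Rightarrow> real"
  assumes [measurable]: "f \<in> borel_measurable borel"
  shows "(\<integral>x. f x \<partial>unif01) = (\<integral>x. f x * indicator {0..1} x \<partial>lborel)"
proof -
  have "unif01 = density lborel (\<lambda>x. ennreal (indicator {0..1} x))"
    unfolding unif01_def uniform_measure_def by (intro arg_cong[where f = "density lborel"] ext)
      (auto simp: indicator_def divide_ennreal_def)
  then have "(\<integral>x. f x \<partial>unif01) = (\<integral>x. f x \<partial>density lborel (\<lambda>x. ennreal (indicator {0..1} x)))"
    by (rule arg_cong)
  then show ?thesis by (subst (asm) integral_density) (auto simp: mult.commute)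
qed

lemma integral_unif01_greaterThan:
  assumes "0 \<le> c" "c \<le> 1"
  shows "(\<integral>x. indicat_real {c<..} x \<partial>unif01) = 1 - c"
  using measure_unif01_greaterThan[OF assms] by simp

lemma integral_unif01_id_greaterThan:
  assumes "0 \<le> c" "c \<le> 1"
  shows "(\<integral>x. x * indicat_real {c<..} x \<partial>unif01) = (1 - c\<^sup>2) / 2"
proof -
  have "(\<integral>x. x * indicat_real {c<..} x \<partial>unif01) = (\<integral>x. x ^ 1 * indicator {c..1} x \<partial>lborel)"
  proof (subst integral_unif01, simp, rule integral_cong_AE)
    show "AE x in lborel. x * indicat_real {c<..} x * indicat_real {0..1} x = x ^ 1 * indicat_real {c..1} x"
      using AE_lborel_singleton[of c] assms by (auto simp: indicator_def elim!: eventually_mono)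
  qed auto
  also have "\<dots> = (1 - c\<^sup>2) / 2"
    using integral_power[of c 1 1] assms by (simp add: power2_eq_square)
  finally show ?thesis .
qed

text \<open>Self-similarity of the uniform law: conditioned on \<open>x \<le> \<beta>\<close>, the
  variable \<open>x / \<beta>\<close> is again uniform. The exchange of \<open>G2\<close> with low
  members of \<open>G1\<close> rests on it.\<close>

lemma emeasure_unif01_scale:
  assumes "0 < \<beta>" "\<beta> \<le> 1" and [measurable]: "A \<in> sets borel"
  shows "emeasure unif01 {x. x \<le> \<beta> \<and> x / \<beta> \<in> A} = ennreal \<beta> * emeasure unif01 A"
proof -
  have m [measurable]: "{x. x \<le> \<beta> \<and> x / \<beta> \<in> A} \<in> sets borel" by measurable
  have "emeasure unif01 {x. x \<le> \<beta> \<and> x / \<beta> \<in> A}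
      = (\<integral>\<^sup>+x. indicator ({0..1} \<inter> {x. x \<le> \<beta> \<and> x / \<beta> \<in> A}) x \<partial>lborel)"
    by (simp add: emeasure_unif01)
  also have "\<dots> = ennreal \<bar>\<beta>\<bar> * (\<integral>\<^sup>+x. indicator ({0..1} \<inter> {x. x \<le> \<beta> \<and> x / \<beta> \<in> A}) (0 + \<beta> * x) \<partial>lborel)"
    using assms by (intro nn_integral_real_affine) auto
  also have "(\<lambda>x. indicator ({0..1} \<inter> {x. x \<le> \<beta> \<and> x / \<beta> \<in> A}) (0 + \<beta> * x) :: ennreal) = indicator ({0..1} \<inter> A)"
  proof
    fix x :: real
    have "0 \<le> \<beta> * x \<and> \<beta> * x \<le> 1 \<and> \<beta> * x \<le> \<beta> \<longleftrightarrow> 0 \<le> x \<and> x \<le> 1"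
      using assms by (auto simp: zero_le_mult_iff mult_le_one)
    then show "indicator ({0..1} \<inter> {x. x \<le> \<beta> \<and> x / \<beta> \<in> A}) (0 + \<beta> * x) = (indicator ({0..1} \<inter> A) x :: ennreal)"
      using assms by (auto simp: indicator_def)
  qed
  also have "(\<integral>\<^sup>+x. indicator ({0..1} \<inter> A) x \<partial>lborel) = emeasure unif01 A"
    by (simp add: emeasure_unif01)
  finally show ?thesis using assms by simp
qed

interpretation unif: product_sigma_finite "\<lambda>_::nat. unif01"
  by (intro product_sigma_finite.intro prob_space_imp_sigma_finite prob_space_unif01)

abbreviation utils :: "nat \<Rightarrow> (nat \<Rightarrow> real) measure" where
  "utils n \<equiv> \<Pi>\<^sub>M i\<in>{..<n}. unif01"

interpretation utils: prob_space "utils n" for n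
  by (intro prob_space_PiM prob_space_unif01)

lemma measurable_utils_component: "i < n \<Longrightarrow> (\<lambda>u. u i) \<in> borel_measurable (utils n)"
  using measurable_component_singleton[of i "{..<n}" "\<lambda>_. unif01"] by (simp cong: measurable_cong_sets)

lemma AE_utils_bounds: "AE u in utils n. \<forall>i<n. 0 \<le> u i \<and> u i \<le> 1"
proof -
  have "AE u in utils n. 0 \<le> u i \<and> u i \<le> 1" if "i < n" for i
    using that by (intro AE_PiM_component prob_space_unif01 AE_unif01) auto
  then have "AE u in utils n. \<forall>i\<in>{..<n}. 0 \<le> u i \<and> u i \<le> 1"
    by (intro AE_finite_allI) auto
  then show ?thesis by (simp only: Ball_def lessThan_iff)
qed

text \<open>With the other coordinates fixed, equality holds for a single value of
  \<open>u i\<close>, which is a null event.\<close>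

lemma AE_utils_neq:
  assumes "i < n" "j < n" "i \<noteq> j" "a \<noteq> 0"
  shows "AE u in utils n. a * u i \<noteq> b * u j"
proof -
  define I where "I = {..<n} - {i}"
  have I: "finite I" "i \<notin> I" "{..<n} = insert i I" using assms by (auto simp: I_def)
  let ?S = "{u \<in> space (utils n). a * u i = b * u j}"
  note [measurable] = measurable_utils_component[OF assms(1)] measurable_utils_component[OF assms(2)]
  have S [measurable]: "?S \<in> sets (utils n)" by measurable
  have "emeasure (utils n) ?S = (\<integral>\<^sup>+u. indicator ?S u \<partial>utils n)" by simp
  also have "\<dots> = (\<integral>\<^sup>+x. (\<integral>\<^sup>+y. indicator ?S (x(i := y)) \<partial>unif01) \<partial>(\<Pi>\<^sub>M i\<in>I. unif01))"
    unfolding I(3)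
    by (intro unif.product_nn_integral_insert I(1,2), simp only: I(3)[symmetric])
      (rule borel_measurable_indicator[OF S])
  also have "\<dots> \<le> (\<integral>\<^sup>+x. 0 \<partial>(\<Pi>\<^sub>M i\<in>I. unif01))"
  proof (intro nn_integral_mono)
    fix x
    have "(\<integral>\<^sup>+y. indicator ?S (x(i := y)) \<partial>unif01) \<le> (\<integral>\<^sup>+y. indicator {b * x j / a} y \<partial>unif01)"
      using assms by (intro nn_integral_mono) (auto simp: indicator_def field_simps)
    also have "\<dots> = 0" using emeasure_unif01_singleton by (subst nn_integral_indicator) auto
    finally show "(\<integral>\<^sup>+y. indicator ?S (x(i := y)) \<partial>unif01) \<le> 0" .
  qed
  finally have "emeasure (utils n) ?S = 0" by simp
  then show ?thesis using S by (intro AE_I[of _ _ ?S]) auto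
qed

text \<open>Second moment method: independence removes the mixed terms, each square contributes at
  most 1, and the mean of \<open>\<bar>S u\<bar>\<close> is at most the root of the second
  moment.\<close>

lemma abs_deviation_sum_le:
  fixes f :: "nat \<Rightarrow> real \<Rightarrow> real"
  assumes J: "J \<subseteq> {..<n}"
    and [measurable]: "\<And>i. i \<in> J \<Longrightarrow> f i \<in> borel_measurable borel"
    and f: "\<And>i x. i \<in> J \<Longrightarrow> 0 \<le> x \<Longrightarrow> x \<le> 1 \<Longrightarrow> 0 \<le> f i x \<and> f i x \<le> 1"
  defines "S \<equiv> \<lambda>u. (\<Sum>i\<in>J. f i (u i)) - (\<Sum>i\<in>J. \<integral>x. f i x \<partial>unif01)"
  shows "integrable (utils n) (\<lambda>u. \<bar>S u\<bar>)" "(\<integral>u. \<bar>S u\<bar> \<partial>utils n) \<le> sqrt (real n)"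
proof -
  interpret D: prob_space unif01 by (rule prob_space_unif01)
  define m where "m i = (\<integral>x. f i x \<partial>unif01)" for i
  define g where "g i x = f i x - m i" for i x
  have finJ: "finite J" using J finite_subset by blast
  have fAE: "AE x in unif01. 0 \<le> f i x \<and> f i x \<le> 1" if "i \<in> J" for i
    using AE_unif01 by (rule eventually_mono) (use f[OF that] in blast)
  have fint: "integrable unif01 (f i)" if "i \<in> J" for i
  proof (rule D.integrable_const_bound[where B = 1])
    show "AE x in unif01. norm (f i x) \<le> 1"
      using fAE[OF that] by (rule eventually_mono) simp
  qed (use assms(2)[OF that] in simp)
  have m: "0 \<le> m i \<and> m i \<le> 1" if "i \<in> J" for i
  proof
    show "0 \<le> m i" unfolding m_def
      by (rule integral_nonneg_AE, rule eventually_mono[OF fAE[OF that]]) simp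
    have "m i \<le> (\<integral>x. 1 \<partial>unif01)" unfolding m_def
      by (rule integral_mono_AE[OF fint[OF that]], simp, rule eventually_mono[OF fAE[OF that]]) simp
    then show "m i \<le> 1" using D.prob_space by simp
  qed
  have gm [measurable]: "g i \<in> borel_measurable borel" if "i \<in> J" for i
    unfolding g_def using that by measurable
  have gb: "\<bar>g i x\<bar> \<le> 1" if "i \<in> J" "0 \<le> x" "x \<le> 1" for i x
    using m[OF that(1)] f[OF that] unfolding g_def by auto
  have gint: "integrable unif01 (g i)" if "i \<in> J" for i
    unfolding g_def using fint[OF that] by auto
  have g0: "(\<integral>x. g i x \<partial>unif01) = 0" if "i \<in> J" for i
    unfolding g_def using fint[OF that] D.prob_space by (simp add: m_def)
  have gu [measurable]: "(\<lambda>u. g i (u i)) \<in> borel_measurable (utils n)" if "i \<in> J" for i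
    using that J by (intro measurable_compose[OF measurable_utils_component gm]) auto
  have AEg: "AE u in utils n. \<forall>i\<in>J. \<bar>g i (u i)\<bar> \<le> 1"
    by (rule eventually_mono[OF AE_utils_bounds]) (use J gb in blast)
  have ggint: "integrable (utils n) (\<lambda>u. g i (u i) * g j (u j))" if "i \<in> J" "j \<in> J" for i j
  proof (rule utils.integrable_const_bound[where B = 1])
    show "AE u in utils n. norm (g i (u i) * g j (u j)) \<le> 1"
      using AEg by eventually_elim (use that in \<open>auto simp: abs_mult intro!: mult_le_one\<close>)
  qed (use that in measurable)
  have gg: "(\<integral>u. g i (u i) * g j (u j) \<partial>utils n) \<le> (if i = j then 1 else 0)"
    if ij: "i \<in> J" "j \<in> J" for i j
  proof (cases "i = j")
    case True
    have "(\<integral>u. g i (u i) * g j (u j) \<partial>utils n) \<le> (\<integral>u. 1 \<partial>utils n)"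
    proof (rule integral_mono_AE[OF ggint[OF ij]])
      show "AE u in utils n. g i (u i) * g j (u j) \<le> 1"
        using AEg
      proof eventually_elim
        case (elim u)
        then have "\<bar>g i (u i) * g j (u j)\<bar> \<le> 1" using ij by (auto simp: abs_mult intro!: mult_le_one)
        then show ?case by simp
      qed
    qed simp
    then show ?thesis using True utils.prob_space by simp
  next
    case False
    \<comment> \<open>Pads the two factors with ones, so that the product rule over all coordinates
      applies.\<close>
    define h where "h l = (if l = i then g i else if l = j then g j else (\<lambda>_. 1))" for l
    have "(\<integral>u. (\<Prod>l\<in>{..<n}. h l (u l)) \<partial>utils n) = (\<Prod>l\<in>{..<n}. \<integral>x. h l x \<partial>unif01)"
      by (rule unif.product_integral_prod) (use gint ij in \<open>auto simp: h_def\<close>)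
    also have "\<dots> = 0"
      using ij J g0 by (intro prod_zero) (auto simp: h_def)
    finally have *: "(\<integral>u. (\<Prod>l\<in>{..<n}. h l (u l)) \<partial>utils n) = 0" .
    have "(\<Prod>l\<in>{..<n}. h l (u l)) = g i (u i) * g j (u j)" for u
    proof -
      have "(\<Prod>l\<in>{..<n}. h l (u l)) = (\<Prod>l\<in>{i, j}. h l (u l))"
        using ij J by (intro prod.mono_neutral_right) (auto simp: h_def)
      then show ?thesis using False by (simp add: h_def)
    qed
    with * show ?thesis using False by simp
  qed
  have S: "S u = (\<Sum>i\<in>J. g i (u i))" for u
    by (simp add: S_def g_def m_def sum_subtractf)
  have Sm [measurable]: "S \<in> borel_measurable (utils n)"
    unfolding S[abs_def] by measurable
  have S2: "(S u)\<^sup>2 = (\<Sum>i\<in>J. \<Sum>j\<in>J. g i (u i) * g j (u j))" for u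
    by (simp add: S power2_eq_square sum_product)
  have S2int: "integrable (utils n) (\<lambda>u. (S u)\<^sup>2)"
    unfolding S2 using ggint by (intro Bochner_Integration.integrable_sum) auto
  show int: "integrable (utils n) (\<lambda>u. \<bar>S u\<bar>)"
    using utils.square_integrable_imp_integrable[OF Sm S2int] by simp
  have "(\<integral>u. (S u)\<^sup>2 \<partial>utils n) = (\<Sum>i\<in>J. \<Sum>j\<in>J. \<integral>u. g i (u i) * g j (u j) \<partial>utils n)"
    unfolding S2 using ggint
    by (simp add: Bochner_Integration.integral_sum)
  also have "\<dots> \<le> (\<Sum>i\<in>J. \<Sum>j\<in>J. if i = j then 1 else 0)"
    by (intro sum_mono gg)
  also have "\<dots> = real (card J)" using finJ by (simp add: sum.delta)
  also have "\<dots> \<le> real n" using card_mono[OF _ J] by simp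
  finally have "(\<integral>u. (S u)\<^sup>2 \<partial>utils n) \<le> real n" .
  \<comment> \<open>This is the nonnegativity of the variance of
    \<open>\<bar>S u\<bar>\<close>.\<close>
  moreover have "(\<integral>u. \<bar>S u\<bar> \<partial>utils n)\<^sup>2 \<le> (\<integral>u. (S u)\<^sup>2 \<partial>utils n)"
    using utils.variance_eq[OF int] S2int utils.variance_positive[of n "\<lambda>u. \<bar>S u\<bar>"] by simp
  ultimately show "(\<integral>u. \<bar>S u\<bar> \<partial>utils n) \<le> sqrt (real n)"
    by (intro real_le_rsqrt) simp
qed

subsection \<open>Exchanging two estimated utilities\<close>

text \<open>For \<open>i\<close> in \<open>G2\<close> and \<open>j\<close> in \<open>G1\<close> this exchanges the estimated utilities \<open>\<beta> * u i\<close> and \<open>u j\<close>.\<close>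

definition swap_utils :: "real \<Rightarrow> nat \<Rightarrow> nat \<Rightarrow> (nat \<Rightarrow> real) \<Rightarrow> nat \<Rightarrow> real" where
  "swap_utils \<beta> i j u = u(i := u j / \<beta>, j := \<beta> * u i)"

lemma measurable_swap_utils:
  assumes "i < n" "j < n"
  shows "swap_utils \<beta> i j \<in> utils n \<rightarrow>\<^sub>M utils n"
proof -
  have m: "(\<lambda>u. (u(i := u j / \<beta>, j := \<beta> * u i)) l) \<in> utils n \<rightarrow>\<^sub>M unif01" if "l < n" for l
  proof -
    have "(\<lambda>u. (u(i := u j / \<beta>, j := \<beta> * u i)) l) \<in> borel_measurable (utils n)"
      using that assms by (cases "l = j"; cases "l = i") simp_all
    then show ?thesis by (simp cong: measurable_cong_sets)
  qed
  show ?thesis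
    unfolding swap_utils_def[abs_def]
  proof (rule measurable_PiM_single')
    show "(\<lambda>u. u(i := u j / \<beta>, j := \<beta> * u i)) \<in> space (utils n) \<rightarrow> (\<Pi>\<^sub>E i\<in>{..<n}. space unif01)"
      using assms by (auto simp: space_PiM PiE_def extensional_def)
  qed (use m in auto)
qed

text \<open>On the event \<open>u j \<le> \<beta>\<close> the independent quantities
  \<open>\<beta> * u i\<close> and \<open>u j\<close> are both uniform on the interval from 0 to
  \<beta>, so exchanging them changes nothing. Equality of the measures is checked on boxes.\<close>

lemma distr_swap_utils:
  assumes ij: "i < n" "j < n" "i \<noteq> j" and \<beta>: "0 < \<beta>" "\<beta> \<le> 1"
  defines "M \<equiv> density (utils n) (indicator {u. u j \<le> \<beta>})"
  shows "distr M (utils n) (swap_utils \<beta> i j) = M"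
proof -
  note T = measurable_swap_utils[OF ij(1,2), of \<beta>]
  note [measurable] = measurable_utils_component[OF ij(2)]
  have ind [measurable]: "(\<lambda>u. indicator {u. u j \<le> \<beta>} u :: ennreal) \<in> borel_measurable (utils n)"
    unfolding indicator_def mem_Collect_eq by measurable
  define B where "B = {u \<in> space (utils n). u j \<le> \<beta>}"
  have Bs: "B \<in> sets (utils n)" unfolding B_def by measurable
  have emM: "emeasure M X = emeasure (utils n) (B \<inter> X)" if "X \<in> sets (utils n)" for X
  proof -
    have "emeasure M X = (\<integral>\<^sup>+u. indicator {u. u j \<le> \<beta>} u * indicator X u \<partial>utils n)"
      unfolding M_def using that by (intro emeasure_density ind)
    also have "\<dots> = (\<integral>\<^sup>+u. indicator (B \<inter> X) u \<partial>utils n)"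
      by (intro nn_integral_cong) (auto simp: B_def indicator_def)
    finally show ?thesis using that Bs by simp
  qed
  have T': "swap_utils \<beta> i j \<in> M \<rightarrow>\<^sub>M utils n" unfolding M_def using T by simp
  have box: "emeasure (distr M (utils n) (swap_utils \<beta> i j)) (Pi\<^sub>E {..<n} A) = emeasure M (Pi\<^sub>E {..<n} A)"
    if A: "\<And>l. l \<in> {..<n} \<Longrightarrow> A l \<in> sets unif01" for A
  proof -
    have Am [measurable]: "A i \<in> sets borel" "A j \<in> sets borel" using A ij by auto
    define A1 where "A1 = A(i := {x. \<beta> * x \<in> A j}, j := {x. x \<le> \<beta> \<and> x / \<beta> \<in> A i})"
    define A2 where "A2 = A(j := {x. x \<le> \<beta> \<and> x \<in> A j})"
    \<comment> \<open>Within \<open>u j \<le> \<beta>\<close>, \<open>A1\<close> is the preimage of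
      the box under the exchange and \<open>A2\<close> the box itself. In both products the scaling
      law yields one factor \<beta>, at coordinate \<open>j\<close>, so they agree up to the order
      of factors.\<close>
    have s1: "{x. \<beta> * x \<in> A j} \<in> sets borel" and s2: "{x. x \<le> \<beta> \<and> x / \<beta> \<in> A i} \<in> sets borel"
      and s3: "{x. x \<le> \<beta> \<and> x \<in> A j} \<in> sets borel"
      by measurable
    have A1: "A1 l \<in> sets unif01" if "l \<in> {..<n}" for l using A that s1 s2 by (auto simp: A1_def)
    have A2: "A2 l \<in> sets unif01" if "l \<in> {..<n}" for l using A that s3 by (auto simp: A2_def)
    have PE: "Pi\<^sub>E {..<n} A \<in> sets (utils n)" using A by (intro sets_PiM_I_finite) auto
    define R where "R = {..<n} - {i, j}"
    have split: "(\<Prod>l\<in>{..<n}. f l) = f i * f j * (\<Prod>l\<in>R. f l)" for f :: "nat \<Rightarrow> ennreal"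
    proof -
      have "{..<n} = insert i (insert j R)" using ij by (auto simp: R_def)
      moreover have "i \<notin> insert j R" "j \<notin> R" "finite R" using ij by (auto simp: R_def)
      ultimately show ?thesis by (simp add: mult.assoc)
    qed
    have scale: "emeasure unif01 {x. x \<le> \<beta> \<and> x \<in> A j} = ennreal \<beta> * emeasure unif01 {x. \<beta> * x \<in> A j}"
      using emeasure_unif01_scale[OF \<beta> s1] \<beta> by simp
    have "emeasure (distr M (utils n) (swap_utils \<beta> i j)) (Pi\<^sub>E {..<n} A)
        = emeasure M (swap_utils \<beta> i j -` Pi\<^sub>E {..<n} A \<inter> space M)"
      using PE by (intro emeasure_distr T')
    also have "\<dots> = emeasure (utils n) (B \<inter> (swap_utils \<beta> i j -` Pi\<^sub>E {..<n} A \<inter> space (utils n)))"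
      using measurable_sets[OF T PE] by (subst emM) (auto simp: M_def)
    also have "B \<inter> (swap_utils \<beta> i j -` Pi\<^sub>E {..<n} A \<inter> space (utils n)) = Pi\<^sub>E {..<n} A1"
    proof (intro set_eqI iffI)
      fix u assume "u \<in> B \<inter> (swap_utils \<beta> i j -` Pi\<^sub>E {..<n} A \<inter> space (utils n))"
      then have u: "u j \<le> \<beta>" "u \<in> extensional {..<n}" "\<And>l. l < n \<Longrightarrow> swap_utils \<beta> i j u l \<in> A l"
        by (auto simp: B_def space_PiM PiE_def)
      show "u \<in> Pi\<^sub>E {..<n} A1"
      proof (rule PiE_I)
        fix l assume l: "l \<in> {..<n}"
        show "u l \<in> A1 l"
          using u(1) u(3)[of l] u(3)[of i] u(3)[of j] ij l by (auto simp: A1_def swap_utils_def split: if_splits)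
      qed (use u(2) in \<open>auto simp: extensional_def\<close>)
    next
      fix u assume u: "u \<in> Pi\<^sub>E {..<n} A1"
      then have u': "u j \<le> \<beta>" "u j / \<beta> \<in> A i" "\<beta> * u i \<in> A j"
        using ij PiE_mem[of u "{..<n}" A1 i] PiE_mem[of u "{..<n}" A1 j] by (auto simp: A1_def)
      have u3: "u l \<in> A l" if "l < n" "l \<noteq> i" "l \<noteq> j" for l
        using PiE_mem[OF u, of l] that by (auto simp: A1_def)
      have ext: "u \<in> extensional {..<n}" using u by (auto simp: PiE_def)
      have "swap_utils \<beta> i j u \<in> Pi\<^sub>E {..<n} A"
      proof (rule PiE_I)
        fix l assume "l \<in> {..<n}"
        then show "swap_utils \<beta> i j u l \<in> A l" using u' u3[of l] ij by (auto simp: swap_utils_def)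
      next
        fix l assume "l \<notin> {..<n}"
        then show "swap_utils \<beta> i j u l = undefined" using ext ij by (auto simp: swap_utils_def extensional_def)
      qed
      then show "u \<in> B \<inter> (swap_utils \<beta> i j -` Pi\<^sub>E {..<n} A \<inter> space (utils n))"
        using u' ext by (auto simp: B_def space_PiM PiE_def)
    qed
    also have "emeasure (utils n) (Pi\<^sub>E {..<n} A1) = (\<Prod>l\<in>{..<n}. emeasure unif01 (A1 l))"
      using A1 by (intro unif.emeasure_PiM) auto
    also have "\<dots> = emeasure unif01 (A1 i) * emeasure unif01 (A1 j) * (\<Prod>l\<in>R. emeasure unif01 (A1 l))"
      by (rule split)
    also have "\<dots> = emeasure unif01 {x. \<beta> * x \<in> A j} * (ennreal \<beta> * emeasure unif01 (A i)) * (\<Prod>l\<in>R. emeasure unif01 (A l))"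
      using ij emeasure_unif01_scale[OF \<beta> Am(1)]
      by (intro arg_cong2[where f = "(*)"] prod.cong refl) (auto simp: A1_def R_def)
    also have "\<dots> = emeasure unif01 (A2 i) * emeasure unif01 (A2 j) * (\<Prod>l\<in>R. emeasure unif01 (A2 l))"
    proof -
      have "(\<Prod>l\<in>R. emeasure unif01 (A l)) = (\<Prod>l\<in>R. emeasure unif01 (A2 l))"
        by (intro prod.cong) (auto simp: A2_def R_def)
      moreover have "A2 i = A i" "A2 j = {x. x \<le> \<beta> \<and> x \<in> A j}" using ij by (auto simp: A2_def)
      ultimately show ?thesis by (simp only: scale mult_ac)
    qed
    also have "\<dots> = (\<Prod>l\<in>{..<n}. emeasure unif01 (A2 l))"
      by (rule split[symmetric])
    also have "\<dots> = emeasure (utils n) (Pi\<^sub>E {..<n} A2)"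
      using A2 by (intro unif.emeasure_PiM[symmetric]) auto
    also have "Pi\<^sub>E {..<n} A2 = B \<inter> Pi\<^sub>E {..<n} A"
      using ij by (auto simp: A2_def B_def PiE_def Pi_def space_PiM split: if_splits)
    also have "emeasure (utils n) (B \<inter> Pi\<^sub>E {..<n} A) = emeasure M (Pi\<^sub>E {..<n} A)"
      by (rule emM[OF PE, symmetric])
    finally show ?thesis .
  qed
  show ?thesis
  proof (rule measure_eqI_PiM_finite[where I = "{..<n}" and M = "\<lambda>_. unif01" and A = "\<lambda>_. \<Pi>\<^sub>E i\<in>{..<n}. UNIV"])
    show "range (\<lambda>_. \<Pi>\<^sub>E i\<in>{..<n}. UNIV) \<subseteq> prod_algebra {..<n} (\<lambda>_. unif01)"
      by (auto intro!: prod_algebraI_finite)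
    have "emeasure M (\<Pi>\<^sub>E i\<in>{..<n}. UNIV) \<le> 1"
    proof (subst emM)
      show "(\<Pi>\<^sub>E i\<in>{..<n}. UNIV) \<in> sets (utils n)" by (intro sets_PiM_I_finite) auto
    qed (rule utils.emeasure_le_1)
    then show "emeasure (distr M (utils n) (swap_utils \<beta> i j)) (\<Pi>\<^sub>E i\<in>{..<n}. UNIV) \<noteq> \<infinity>"
      by (subst box) (auto simp: top_unique)
  next
    fix A :: "nat \<Rightarrow> real set" assume "\<And>l. l \<in> {..<n} \<Longrightarrow> A l \<in> sets unif01"
    then show "emeasure (distr M (utils n) (swap_utils \<beta> i j)) (Pi\<^sub>E {..<n} A) = emeasure M (Pi\<^sub>E {..<n} A)"
      by (rule box)
  qed (auto simp: space_PiM M_def)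
qed

lemma integral_swap_utils:
  fixes h :: "(nat \<Rightarrow> real) \<Rightarrow> real"
  assumes ij: "i < n" "j < n" "i \<noteq> j" and \<beta>: "0 < \<beta>" "\<beta> \<le> 1"
    and [measurable]: "h \<in> borel_measurable (utils n)"
  shows "(\<integral>u. indicator {u. u j \<le> \<beta>} u * h (swap_utils \<beta> i j u) \<partial>utils n)
    = (\<integral>u. indicator {u. u j \<le> \<beta>} u * h u \<partial>utils n)"
proof -
  let ?M = "density (utils n) (\<lambda>u. ennreal (indicator {u. u j \<le> \<beta>} u))"
  have M: "density (utils n) (indicator {u. u j \<le> \<beta>}) = ?M"
    by (intro arg_cong[where f = "density (utils n)"] ext) (auto simp: indicator_def)
  note [measurable] = measurable_utils_component[OF ij(2)]
  have ind [measurable]: "(\<lambda>u. indicator {u. u j \<le> \<beta>} u :: real) \<in> borel_measurable (utils n)"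
    unfolding indicator_def mem_Collect_eq by measurable
  note T [measurable] = measurable_swap_utils[OF ij(1,2), of \<beta>]
  have hT [measurable]: "(\<lambda>u. h (swap_utils \<beta> i j u)) \<in> borel_measurable (utils n)"
    by (rule measurable_compose[OF T]) simp
  have T': "swap_utils \<beta> i j \<in> ?M \<rightarrow>\<^sub>M utils n" by simp
  have "(\<integral>u. indicator {u. u j \<le> \<beta>} u * h (swap_utils \<beta> i j u) \<partial>utils n) = (\<integral>u. h (swap_utils \<beta> i j u) \<partial>?M)"
    by (subst integral_density) auto
  also have "\<dots> = (\<integral>u. h u \<partial>distr ?M (utils n) (swap_utils \<beta> i j))"
    by (rule integral_distr[OF T', symmetric]) simp
  also have "\<dots> = (\<integral>u. h u \<partial>?M)"
    using distr_swap_utils[OF ij \<beta>] unfolding M by simp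
  also have "\<dots> = (\<integral>u. indicator {u. u j \<le> \<beta>} u * h u \<partial>utils n)"
    by (subst integral_density) auto
  finally show ?thesis .
qed

subsection \<open>Candidates in the order of their estimated utilities\<close>

lemma measurable_insort_key:
  assumes "\<And>i. i \<in> insert x (set ys) \<Longrightarrow> (\<lambda>u. f u i :: real) \<in> borel_measurable M"
  shows "(\<lambda>u. insort_key (f u) x ys) \<in> M \<rightarrow>\<^sub>M count_space UNIV"
  using assms
proof (induction ys)
  case (Cons y ys)
  have IH: "(\<lambda>u. insort_key (f u) x ys) \<in> M \<rightarrow>\<^sub>M count_space UNIV"
    using Cons by auto
  have [measurable]: "(\<lambda>u. f u x) \<in> borel_measurable M" "(\<lambda>u. f u y) \<in> borel_measurable M"
    using Cons.prems by auto
  have [measurable]: "(\<lambda>u. y # insort_key (f u) x ys) \<in> M \<rightarrow>\<^sub>M count_space UNIV"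
    by (rule measurable_compose[OF IH]) simp
  have "(\<lambda>u. if f u x \<le> f u y then x # y # ys else y # insort_key (f u) x ys) \<in> M \<rightarrow>\<^sub>M count_space UNIV"
    by measurable
  then show ?case by simp
qed simp

text \<open>The sorted tail takes values in a countable set of lists; with the tail fixed, an
  insertion is a finite chain of comparisons.\<close>

lemma measurable_sort_key:
  fixes xs :: "nat list"
  assumes "\<And>i. i \<in> set xs \<Longrightarrow> (\<lambda>u. f u i :: real) \<in> borel_measurable M"
  shows "(\<lambda>u. sort_key (f u) xs) \<in> M \<rightarrow>\<^sub>M count_space UNIV"
  using assms
proof (induction xs)
  case (Cons x xs)
  have m: "(\<lambda>u. sort_key (f u) xs) \<in> M \<rightarrow>\<^sub>M count_space (lists (set xs))"
  proof (rule measurable_count_space_extend[OF subset_UNIV])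
    show "(\<lambda>u. sort_key (f u) xs) \<in> M \<rightarrow>\<^sub>M count_space UNIV" using Cons by simp
    show "(\<lambda>u. sort_key (f u) xs) \<in> space M \<rightarrow> lists (set xs)" by (intro funcsetI) (simp add: in_lists_conv_set)
  qed
  have "(\<lambda>u. insort_key (f u) x (sort_key (f u) xs)) \<in> M \<rightarrow>\<^sub>M count_space UNIV"
  proof (rule measurable_compose_countable'[OF _ m])
    fix ys assume "ys \<in> lists (set xs)"
    then show "(\<lambda>u. insort_key (f u) x ys) \<in> M \<rightarrow>\<^sub>M count_space UNIV"
      using Cons.prems by (intro measurable_insort_key) auto
  qed simp
  then show ?case by simp
qed simp

definition rank_list :: "nat \<Rightarrow> (nat \<Rightarrow> real) \<Rightarrow> nat list" where
  "rank_list n v = sort_key (\<lambda>i. - v i) [0..<n]"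

lemma rank_list_simps [simp]:
  "set (rank_list n v) = {..<n}" "distinct (rank_list n v)" "length (rank_list n v) = n"
  "sorted (map (\<lambda>i. - v i) (rank_list n v))"
  by (auto simp: rank_list_def)

lemma card_top: "m \<le> n \<Longrightarrow> card (set (take m (rank_list n v))) = m"
  by (simp add: distinct_card)

lemma top_subset: "set (take m (rank_list n v)) \<subseteq> {..<n}"
  by (metis rank_list_simps(1) set_take_subset)

lemma measurable_rank_list:
  assumes "\<And>i. i < n \<Longrightarrow> (\<lambda>u. v u i) \<in> borel_measurable M"
  shows "(\<lambda>u. rank_list n (v u)) \<in> M \<rightarrow>\<^sub>M count_space UNIV"
  unfolding rank_list_def using assms by (intro measurable_sort_key borel_measurable_uminus) auto

text \<open>Presents the optimum as selection by the unbiased order, so that the same threshold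
  comparison applies to it.\<close>

lemma opt_utility_rank_list:
  assumes "K \<le> n"
  shows "opt_utility n K u = (\<Sum>i\<in>set (take K (rank_list n u)). u i)"
proof -
  have "sort (map u [0..<n]) = rev (map u (rank_list n u))"
  proof (rule properties_for_sort)
    show "mset (rev (map u (rank_list n u))) = mset (map u [0..<n])"
      by (simp add: rank_list_def)
    have "sorted_wrt (\<lambda>x y. u x \<ge> u y) (rank_list n u)"
      using rank_list_simps(4)[of u n] by (simp add: sorted_map)
    then show "sorted (rev (map u (rank_list n u)))"
      by (simp add: sorted_wrt_rev sorted_wrt_map)
  qed
  then have "opt_utility n K u = sum_list (map u (take K (rank_list n u)))"
    by (simp add: opt_utility_def take_map)
  also have "\<dots> = (\<Sum>i\<in>set (take K (rank_list n u)). u i)"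
    by (intro sum_list_distinct_conv_sum_set distinct_take) simp
  finally show ?thesis .
qed

text \<open>The differences \<open>A - B\<close> and \<open>B - A\<close> have equal size, and the
  maximum over the former lies below every value in \<open>B\<close>. The consequence used is that
  the utility ratio is at most 1.\<close>

lemma sum_le_sum_top:
  assumes A: "A \<subseteq> {..<n}" "card A = K"
  shows "(\<Sum>i\<in>A. v i) \<le> (\<Sum>i\<in>set (take K (rank_list n v)). v i)"
proof -
  define B where "B = set (take K (rank_list n v))"
  have fin: "finite A" "finite B" using A finite_subset by (auto simp: B_def)
  have "K \<le> n" using card_mono[OF _ A(1)] A(2) by simp
  then have cB: "card B = K" unfolding B_def by (rule card_top)
  have "card (A - B) + card (A \<inter> B) = card A" "card (B - A) + card (A \<inter> B) = card B"
    using fin by (simp_all add: card_Diff_subset_Int card_mono Int_commute)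
  then have card_eq: "card (A - B) = card (B - A)" using cB A by simp
  show ?thesis
  proof (cases "A - B = {}")
    case True
    then have "card (A - B) = 0" by (simp only: card.empty)
    then have "card (B - A) = 0" using card_eq by simp
    then have "A = B" using True fin by auto
    then show ?thesis by (simp add: B_def)
  next
    case False
    define t where "t = Max (v ` (A - B))"
    have at: "v i \<le> t" if "i \<in> A - B" for i
      unfolding t_def using that fin by (intro Max_ge) auto
    have "t \<in> v ` (A - B)" unfolding t_def using fin False by (intro Max_in) auto
    then obtain a where a: "a \<in> A - B" "v a = t" by blast
    \<comment> \<open>Otherwise the set of values above \<open>v b\<close> contains \<open>a\<close>
      but not \<open>b\<close>, hence is not nested with \<open>B\<close>.\<close>
    have bt: "t \<le> v b" if b: "b \<in> B" for b
    proof (rule ccontr)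
      assume "\<not> t \<le> v b"
      then have lt: "v b < v a" using a by simp
      from take_sorted_threshold[OF rank_list_simps(4)[of v n], of K "v b"]
      have "B \<subseteq> {i \<in> {..<n}. v b < v i} \<or> {i \<in> {..<n}. v b < v i} \<subseteq> B"
        by (simp add: B_def)
      then show False using b a lt A by auto
    qed
    have "(\<Sum>i\<in>A - B. v i) \<le> real (card (A - B)) * t"
      using at by (intro sum_bounded_above) auto
    also have "\<dots> = real (card (B - A)) * t" by (simp add: card_eq)
    also have "\<dots> \<le> (\<Sum>i\<in>B - A. v i)" using bt by (intro sum_bounded_below) auto
    finally have "(\<Sum>i\<in>A - B. v i) \<le> (\<Sum>i\<in>B - A. v i)" .
    moreover have "(\<Sum>i\<in>A. v i) = (\<Sum>i\<in>A \<inter> B. v i) + (\<Sum>i\<in>A - B. v i)"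
      using fin by (simp add: sum.Int_Diff[of A _ B])
    moreover have "(\<Sum>i\<in>B. v i) = (\<Sum>i\<in>A \<inter> B. v i) + (\<Sum>i\<in>B - A. v i)"
      using fin by (simp add: sum.Int_Diff[of B _ A] Int_commute)
    ultimately show ?thesis by (simp add: B_def)
  qed
qed

lemma min_max_ratio_bounds:
  assumes "0 \<le> x" "0 \<le> y"
  shows "0 \<le> min_max_ratio x y" "min_max_ratio x y \<le> 1"
  using assms by (auto simp: min_max_ratio_def min_def max_def divide_simps)

lemma min_max_ratio_le_divide:
  assumes "0 \<le> x" "0 \<le> y"
  shows "min_max_ratio x y \<le> y / x"
  using assms by (auto simp: min_max_ratio_def min_def max_def divide_simps intro: mult_mono)

text \<open>\<open>(1 - x) / x\<close> equals \<beta> at \<open>x = 1 / (1 + \<beta>)\<close>, which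
  is at least \<open>1 / 2\<close>; the factor 4 is a Lipschitz bound around this point.\<close>

lemma min_max_ratio_complement:
  assumes x: "0 \<le> x" "x \<le> 1" and \<beta>: "0 < \<beta>" "\<beta> \<le> 1"
  shows "\<bar>min_max_ratio x (1 - x) - \<beta>\<bar> \<le> 4 * \<bar>x - 1 / (1 + \<beta>)\<bar>"
proof (cases "1 / 2 \<le> x")
  case True
  define w where "w = 1 / (1 + \<beta>)"
  have w: "w * (1 + \<beta>) = 1" using \<beta> by (simp add: w_def)
  have "min_max_ratio x (1 - x) - \<beta> = (1 + \<beta>) / x * (w - x)"
  proof -
    have "min_max_ratio x (1 - x) - \<beta> = (1 - x) / x - \<beta>"
      using True by (simp add: min_max_ratio_def)
    also have "\<dots> = (1 - x * (1 + \<beta>)) / x" using True by (simp add: field_simps)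
    also have "\<dots> = (w * (1 + \<beta>) - x * (1 + \<beta>)) / x" by (simp only: w)
    also have "\<dots> = (1 + \<beta>) / x * (w - x)" using True by (simp add: field_simps)
    finally show ?thesis .
  qed
  then have "\<bar>min_max_ratio x (1 - x) - \<beta>\<bar> = (1 + \<beta>) / x * \<bar>w - x\<bar>"
    using True \<beta> by (simp add: abs_mult)
  also have "\<dots> \<le> 4 * \<bar>w - x\<bar>"
    using True \<beta> by (intro mult_right_mono) (auto simp: divide_simps)
  finally show ?thesis by (simp add: w_def abs_minus_commute)
next
  case False
  \<comment> \<open>Now the ratio is \<open>x / (1 - x)\<close>. Both \<open>r\<close> and \<beta>
    are at most 1, the value at \<open>x = 1 / 2\<close>; their gaps to 1 are compared with the two
    pieces into which \<open>1 / 2\<close> cuts the interval from \<open>x\<close> to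
    \<open>1 / (1 + \<beta>)\<close>.\<close>
  define r where "r = x / (1 - x)"
  have r: "min_max_ratio x (1 - x) = r" using False by (simp add: min_max_ratio_def r_def)
  have wh: "(1 - \<beta>) / 4 \<le> 1 / (1 + \<beta>) - 1 / 2"
  proof -
    have "0 \<le> (1 - \<beta>) * (1 - \<beta>)" using \<beta> by simp
    then show ?thesis using \<beta> by (simp add: field_simps)
  qed
  have r1: "r \<le> 1" using False x by (simp add: r_def divide_simps)
  have "1 - r = (1 - 2 * x) / (1 - x)" using False by (simp add: r_def field_simps)
  also have "\<dots> \<le> 2 * (1 - 2 * x)"
  proof -
    have "0 \<le> (1 - 2 * x) * (1 - 2 * x)" by simp
    then show ?thesis using False by (simp add: field_simps)
  qed
  finally have r2: "1 - r \<le> 4 * (1 / 2 - x)" by simp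
  have hw: "1 / 2 \<le> 1 / (1 + \<beta>)" using \<beta> by (simp add: field_simps)
  define w where "w = 1 / (1 + \<beta>)"
  note wh = wh[folded w_def] and hw = hw[folded w_def]
  have "r - \<beta> \<le> 4 * (w - x)" using r1 wh False by simp
  moreover have "\<beta> - r \<le> 4 * (w - x)" using r2 hw \<beta> by simp
  moreover have "\<bar>x - w\<bar> = w - x" using hw False by simp
  ultimately show ?thesis unfolding r w_def[symmetric] by (simp only: abs_le_iff) simp
qed

subsection \<open>Representation\<close>

locale selection =
  fixes n K p :: nat and k :: "nat \<Rightarrow> nat" and G1 G2 :: "nat set" and L :: "nat list pmf" and \<beta> :: real
  assumes K_eq: "K = (\<Sum>l<p. k l)" and K_pos: "1 \<le> K"
    and G_Un: "G1 \<union> G2 = {..<n}" and G_Int: "G1 \<inter> G2 = {}"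
    and card_G1: "card G1 = K" and card_G2: "card G2 = K"
    and L_perm: "set_pmf L \<subseteq> permutations_of_set {..<p}"
    and \<beta>_pos: "0 < \<beta>" and \<beta>_le: "\<beta> \<le> 1"
begin

lemma p_pos: "0 < p"
  using K_eq K_pos by (cases p) auto

lemma finite_G [simp]: "finite G1" "finite G2"
  using G_Un by (metis finite_Un finite_lessThan)+

lemma G_less: "i \<in> G1 \<Longrightarrow> i < n" "i \<in> G2 \<Longrightarrow> i < n"
  using G_Un by blast+

lemma n_eq: "n = 2 * K"
  using card_Un_disjoint[OF finite_G G_Int] G_Un card_G1 card_G2 by simp

abbreviation est :: "(nat \<Rightarrow> real) \<Rightarrow> nat \<Rightarrow> real" where
  "est \<equiv> est_utility G2 \<beta>"

abbreviation ord :: "(nat \<Rightarrow> real) \<Rightarrow> nat list" where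
  "ord u \<equiv> rank_list n (est u)"

definition top :: "(nat \<Rightarrow> real) \<Rightarrow> nat set" where
  "top u = set (take K (ord u))"

abbreviation prefs :: "(nat \<Rightarrow> nat list) pmf" where
  "prefs \<equiv> Pi_pmf {..<n} [] (\<lambda>_. L)"

lemma top_props: "top u \<subseteq> {..<n}" "finite (top u)" "card (top u) = K"
  unfolding top_def using top_subset card_top n_eq by auto

lemma measurable_est: "i < n \<Longrightarrow> (\<lambda>u. est u i) \<in> borel_measurable (utils n)"
  using measurable_utils_component[of i n] by (cases "i \<in> G2") (simp_all add: est_utility_def)

lemma measurable_ord [measurable]: "ord \<in> utils n \<rightarrow>\<^sub>M count_space UNIV"
  by (intro measurable_rank_list measurable_est)

lemma measurable_ord_fun: "(\<lambda>u. f (ord u)) \<in> borel_measurable (utils n)"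
  by (rule measurable_compose[OF measurable_ord]) simp

lemma profile_eq: "profile_measure n unif01 L = utils n \<Otimes>\<^sub>M measure_pmf prefs"
  by (simp add: profile_measure_def)

text \<open>The order takes countably many values and the preferences carry the discrete
  \<sigma>-algebra, so \<Phi> needs no regularity.\<close>

lemma measurable_profile_ord:
  fixes \<Phi> :: "nat list \<Rightarrow> (nat \<Rightarrow> nat list) \<Rightarrow> real"
  shows "(\<lambda>(u, \<sigma>). \<Phi> (ord u) \<sigma>) \<in> borel_measurable (utils n \<Otimes>\<^sub>M measure_pmf prefs)"
  unfolding case_prod_unfold
proof (rule measurable_compose_countable[where f = "\<lambda>xs w. \<Phi> xs (snd w)"])
  fix xs
  show "(\<lambda>w. \<Phi> xs (snd w)) \<in> borel_measurable (utils n \<Otimes>\<^sub>M measure_pmf prefs)"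
    by (rule measurable_compose[OF measurable_snd]) simp
qed (rule measurable_compose[OF measurable_fst measurable_ord])

lemma prefs_perm: "\<sigma> \<in> set_pmf prefs \<Longrightarrow> i < n \<Longrightarrow> \<sigma> i \<in> permutations_of_set {..<p}"
  using L_perm by (auto simp: set_Pi_pmf PiE_dflt_def)

lemma A_st_eq: "A_st n k (est u) \<sigma> = serial_assign k \<sigma> (ord u)"
  by (simp add: A_st_def rank_list_def)

lemma dom_A_st: "\<sigma> \<in> set_pmf prefs \<Longrightarrow> dom (A_st n k (est u) \<sigma>) = top u"
  unfolding A_st_eq top_def using prefs_perm by (subst dom_serial_assign) (auto simp: K_eq)

sublocale pair: pair_prob_space "utils n" "measure_pmf prefs"
  by unfold_locales

lemma integral_profile_fst:
  fixes F :: "(nat \<Rightarrow> real) \<times> (nat \<Rightarrow> nat list) \<Rightarrow> real"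
  assumes [measurable]: "F \<in> borel_measurable (utils n \<Otimes>\<^sub>M measure_pmf prefs)" "g \<in> borel_measurable (utils n)"
    and eq: "\<And>u \<sigma>. \<sigma> \<in> set_pmf prefs \<Longrightarrow> F (u, \<sigma>) = g u"
  shows "(\<integral>w. F w \<partial>profile_measure n unif01 L) = (\<integral>u. g u \<partial>utils n)"
proof -
  have "(\<integral>w. F w \<partial>(utils n \<Otimes>\<^sub>M measure_pmf prefs)) = (\<integral>w. g (fst w) \<partial>(utils n \<Otimes>\<^sub>M measure_pmf prefs))"
  proof (rule integral_cong_AE)
    show "AE w in utils n \<Otimes>\<^sub>M measure_pmf prefs. F w = g (fst w)"
      by (rule pair.AE_pair_measure) (auto simp: AE_measure_pmf_iff eq)
  qed auto
  also have "\<dots> = (\<integral>u. g u \<partial>distr (utils n \<Otimes>\<^sub>M measure_pmf prefs) (utils n) fst)"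
    by (subst integral_distr) auto
  also have "distr (utils n \<Otimes>\<^sub>M measure_pmf prefs) (utils n) fst = utils n"
    by (rule measure_pmf.distr_pair_fst)
  finally show ?thesis by (simp add: profile_eq)
qed

text \<open>
  \<open>u i\<close> exceeds \<open>cutoff i\<close> iff the estimated utility of \<open>i\<close> exceeds the solution
  \<open>t = \<beta> / (1 + \<beta>)\<close> of \<open>K * (1 - t) + K * (1 - t / \<beta>) = K\<close>.
\<close>

definition cutoff :: "nat \<Rightarrow> real" where
  "cutoff i = (if i \<in> G2 then 1 / (1 + \<beta>) else \<beta> / (1 + \<beta>))"

lemma cutoff_bounds: "0 \<le> cutoff i" "cutoff i \<le> 1"
  using \<beta>_pos by (auto simp: cutoff_def)

lemma cutoff_iff: "\<beta> / (1 + \<beta>) < est u i \<longleftrightarrow> cutoff i < u i"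
proof (cases "i \<in> G2")
  case True
  have "\<beta> / (1 + \<beta>) < est u i \<longleftrightarrow> \<beta> * (1 / (1 + \<beta>)) < \<beta> * u i"
    using True by (simp add: est_utility_def)
  also have "\<dots> \<longleftrightarrow> cutoff i < u i"
    using True \<beta>_pos by (simp only: mult_less_cancel_left_pos cutoff_def if_True)
  finally show ?thesis .
qed (simp add: cutoff_def est_utility_def)

lemma sum_G:
  fixes f :: "nat \<Rightarrow> real"
  shows "(\<Sum>i<n. f i) = (\<Sum>i\<in>G1. f i) + (\<Sum>i\<in>G2. f i)"
  using sum.union_disjoint[OF finite_G G_Int, of f] G_Un by simp

lemma cutoff_G: "i \<in> G1 \<Longrightarrow> cutoff i = \<beta> / (1 + \<beta>)" "i \<in> G2 \<Longrightarrow> cutoff i = 1 / (1 + \<beta>)"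
  using G_Int by (auto simp: cutoff_def)

lemma cutoff_mean_G1: "(\<Sum>i\<in>G1. \<integral>x. indicat_real {cutoff i<..} x \<partial>unif01) = real K / (1 + \<beta>)"
proof -
  have "(\<Sum>i\<in>G1. \<integral>x. indicat_real {cutoff i<..} x \<partial>unif01) = (\<Sum>i\<in>G1. 1 - \<beta> / (1 + \<beta>))"
    by (intro sum.cong refl) (simp only: integral_unif01_greaterThan[OF cutoff_bounds], simp only: cutoff_G)
  then show ?thesis using \<beta>_pos by (simp add: card_G1 field_simps)
qed

lemma cutoff_mean: "(\<Sum>i<n. \<integral>x. indicat_real {cutoff i<..} x \<partial>unif01) = real K"
proof -
  have "(\<Sum>i\<in>G2. \<integral>x. indicat_real {cutoff i<..} x \<partial>unif01) = (\<Sum>i\<in>G2. 1 - 1 / (1 + \<beta>))"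
    by (intro sum.cong refl) (simp only: integral_unif01_greaterThan[OF cutoff_bounds], simp only: cutoff_G)
  then have "(\<Sum>i<n. \<integral>x. indicat_real {cutoff i<..} x \<partial>unif01)
      = real K / (1 + \<beta>) + real K * (1 - 1 / (1 + \<beta>))"
    by (simp only: sum_G cutoff_mean_G1) (simp add: card_G2)
  also have "\<dots> = real K" by (simp add: right_diff_distrib)
  finally show ?thesis .
qed

definition count_dev :: "(nat \<Rightarrow> real) \<Rightarrow> real" where
  "count_dev u = \<bar>(\<Sum>i<n. indicat_real {cutoff i<..} (u i)) - real K\<bar>"

lemma count_dev: "integrable (utils n) count_dev" "(\<integral>u. count_dev u \<partial>utils n) \<le> sqrt (real n)"
  using abs_deviation_sum_le[of "{..<n}" n "\<lambda>i. indicat_real {cutoff i<..}"]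
  unfolding cutoff_mean count_dev_def[abs_def] by (auto simp: indicator_def)

lemma top_sum_diff:
  fixes f :: "nat \<Rightarrow> real"
  assumes "\<And>i. i < n \<Longrightarrow> 0 \<le> f i \<and> f i \<le> 1"
  shows "\<bar>(\<Sum>i\<in>top u. f i) - (\<Sum>i<n. f i * indicator {cutoff i<..} (u i))\<bar> \<le> count_dev u"
proof -
  have eq: "{i \<in> set (ord u). \<beta> / (1 + \<beta>) < est u i} = {i \<in> {..<n}. cutoff i < u i}"
    by (simp add: cutoff_iff)
  have "\<bar>(\<Sum>i\<in>top u. f i) - (\<Sum>i | i \<in> set (ord u) \<and> \<beta> / (1 + \<beta>) < est u i. f i)\<bar>
      \<le> \<bar>real (card {i \<in> set (ord u). \<beta> / (1 + \<beta>) < est u i}) - real K\<bar>"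
    unfolding top_def using assms n_eq by (intro sum_take_threshold_diff) auto
  also have "real (card {i \<in> set (ord u). \<beta> / (1 + \<beta>) < est u i}) = (\<Sum>i<n. indicat_real {cutoff i<..} (u i))"
    unfolding eq by (simp add: indicator_def sum.If_cases Int_def)
  also have "(\<Sum>i | i \<in> set (ord u) \<and> \<beta> / (1 + \<beta>) < est u i. f i) = (\<Sum>i<n. f i * indicator {cutoff i<..} (u i))"
    unfolding eq by (simp add: indicator_def sum.If_cases Int_def)
  finally show ?thesis by (simp add: count_dev_def)
qed

definition sel1 :: "(nat \<Rightarrow> real) \<Rightarrow> nat" where
  "sel1 u = card (G1 \<inter> top u)"

lemma sel1_le: "sel1 u \<le> K"
  unfolding sel1_def using card_mono[of G1 "G1 \<inter> top u"] card_G1 by simp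

lemma sel2_eq: "card (G2 \<inter> top u) = K - sel1 u"
proof -
  have "top u = (G1 \<inter> top u) \<union> (G2 \<inter> top u)" using top_props(1)[of u] G_Un by blast
  then have "card (top u) = card (G1 \<inter> top u) + card (G2 \<inter> top u)"
    using G_Int by (subst card_Un_disjoint[symmetric]) auto
  then show ?thesis by (simp add: top_props sel1_def)
qed

lemma measurable_sel1 [measurable]: "(\<lambda>u. real (sel1 u)) \<in> borel_measurable (utils n)"
  unfolding sel1_def top_def by (rule measurable_ord_fun)

text \<open>Two errors of size \<open>sqrt n\<close>: from the selected members of \<open>G1\<close>
  to those above the cutoff, and from the latter to their mean.\<close>

lemma sel1_dev: "integrable (utils n) (\<lambda>u. \<bar>real (sel1 u) - real K / (1 + \<beta>)\<bar>)"
  "(\<integral>u. \<bar>real (sel1 u) - real K / (1 + \<beta>)\<bar> \<partial>utils n) \<le> 2 * sqrt (real n)"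
proof -
  define d where "d u = \<bar>(\<Sum>i\<in>G1. indicat_real {cutoff i<..} (u i)) - real K / (1 + \<beta>)\<bar>" for u
  have d: "integrable (utils n) d" "(\<integral>u. d u \<partial>utils n) \<le> sqrt (real n)"
    using abs_deviation_sum_le[of G1 n "\<lambda>i. indicat_real {cutoff i<..}"] G_less
    unfolding cutoff_mean_G1 d_def[abs_def] by (auto simp: indicator_def)
  have le: "\<bar>real (sel1 u) - real K / (1 + \<beta>)\<bar> \<le> d u + count_dev u" for u
  proof -
    have "(\<Sum>i\<in>top u. indicat_real G1 i) = real (sel1 u)"
      using top_props(2)[of u] by (simp add: sel1_def indicator_def sum.If_cases Int_def conj_commute)
    moreover have "(\<Sum>i<n. indicat_real G1 i * indicator {cutoff i<..} (u i)) = (\<Sum>i\<in>G1. indicat_real {cutoff i<..} (u i))"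
      using G_Int by (auto simp: sum_G indicator_def intro!: sum.neutral)
    ultimately have "\<bar>real (sel1 u) - (\<Sum>i\<in>G1. indicat_real {cutoff i<..} (u i))\<bar> \<le> count_dev u"
      using top_sum_diff[of "indicat_real G1" u] by (simp add: indicator_def)
    then show ?thesis by (simp add: d_def)
  qed
  have dc: "integrable (utils n) (\<lambda>u. d u + count_dev u)"
    by (intro Bochner_Integration.integrable_add d count_dev)
  have m: "(\<lambda>u. \<bar>real (sel1 u) - real K / (1 + \<beta>)\<bar>) \<in> borel_measurable (utils n)" by measurable
  show int: "integrable (utils n) (\<lambda>u. \<bar>real (sel1 u) - real K / (1 + \<beta>)\<bar>)"
  proof (rule Bochner_Integration.integrable_bound[OF dc m], rule AE_I2)
    fix u
    show "norm \<bar>real (sel1 u) - real K / (1 + \<beta>)\<bar> \<le> norm (d u + count_dev u)"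
      using le[of u] by simp
  qed
  have "(\<integral>u. \<bar>real (sel1 u) - real K / (1 + \<beta>)\<bar> \<partial>utils n) \<le> (\<integral>u. d u + count_dev u \<partial>utils n)"
    by (rule integral_mono[OF int dc le])
  also have "\<dots> \<le> 2 * sqrt (real n)" using d count_dev by simp
  finally show "(\<integral>u. \<bar>real (sel1 u) - real K / (1 + \<beta>)\<bar> \<partial>utils n) \<le> 2 * sqrt (real n)" .
qed

lemma integral_dist_le:
  fixes f g :: "(nat \<Rightarrow> real) \<Rightarrow> real"
  assumes [measurable]: "f \<in> borel_measurable (utils n)" and g: "integrable (utils n) g"
    and le: "AE u in utils n. \<bar>f u - a\<bar> \<le> g u"
  shows "\<bar>(\<integral>u. f u \<partial>utils n) - a\<bar> \<le> (\<integral>u. g u \<partial>utils n)"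
proof -
  have int: "integrable (utils n) (\<lambda>u. f u - a)"
    by (rule Bochner_Integration.integrable_bound[OF g])
      (auto intro: eventually_mono[OF le])
  then have "integrable (utils n) (\<lambda>u. (f u - a) + a)" by (intro Bochner_Integration.integrable_add) auto
  then have "(\<integral>u. f u \<partial>utils n) - a = (\<integral>u. f u - a \<partial>utils n)"
    by (subst Bochner_Integration.integral_diff) (simp_all add: utils.prob_space)
  also have "\<bar>\<dots>\<bar> \<le> (\<integral>u. \<bar>f u - a\<bar> \<partial>utils n)" by (rule integral_abs_bound)
  also have "\<dots> \<le> (\<integral>u. g u \<partial>utils n)"
    using int g le by (intro integral_mono_AE) auto
  finally show ?thesis .
qed

text \<open>The 8 is the Lipschitz factor 4 of \<open>min_max_ratio_complement\<close> times the 2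
  of \<open>sel1_dev\<close>.\<close>

lemma representation_bound:
  "\<bar>representation_metric n G1 G2 \<beta> unif01 L (A_st n k) - \<beta>\<bar> \<le> 8 * sqrt (real n) / real K"
proof -
  define g where "g u = min_max_ratio (real (sel1 u) / real K) (1 - real (sel1 u) / real K)" for u
  have gm [measurable]: "g \<in> borel_measurable (utils n)"
    unfolding g_def min_max_ratio_def by measurable
  have frac: "assigned_frac (A_st n k (est u) \<sigma>) G1 = real (sel1 u) / real K"
    "assigned_frac (A_st n k (est u) \<sigma>) G2 = 1 - real (sel1 u) / real K"
    if "\<sigma> \<in> set_pmf prefs" for u \<sigma>
  proof -
    have "{i \<in> G. A_st n k (est u) \<sigma> i \<noteq> None} = G \<inter> top u" for G
      using dom_A_st[OF that, of u] by (auto simp: dom_def)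
    then show "assigned_frac (A_st n k (est u) \<sigma>) G1 = real (sel1 u) / real K"
      "assigned_frac (A_st n k (est u) \<sigma>) G2 = 1 - real (sel1 u) / real K"
      using sel1_le[of u] K_pos
      by (auto simp: assigned_frac_def card_G1 card_G2 sel2_eq of_nat_diff diff_divide_distrib)
        (simp add: sel1_def)
  qed
  have "representation_metric n G1 G2 \<beta> unif01 L (A_st n k) = (\<integral>u. g u \<partial>utils n)"
    unfolding representation_metric_def
  proof (rule integral_profile_fst)
    show "(\<lambda>(u, \<sigma>). let M = A_st n k (est u) \<sigma> in min_max_ratio (assigned_frac M G1) (assigned_frac M G2))
        \<in> borel_measurable (utils n \<Otimes>\<^sub>M measure_pmf prefs)"
      unfolding A_st_eq by (rule measurable_profile_ord)
  next
    show "g \<in> borel_measurable (utils n)" by (rule gm)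
  qed (simp add: frac g_def)
  also have "\<bar>\<dots> - \<beta>\<bar> \<le> (\<integral>u. 4 / real K * \<bar>real (sel1 u) - real K / (1 + \<beta>)\<bar> \<partial>utils n)"
  proof (rule integral_dist_le)
    have "\<bar>g u - \<beta>\<bar> \<le> 4 / real K * \<bar>real (sel1 u) - real K / (1 + \<beta>)\<bar>" for u
    proof -
      have "\<bar>g u - \<beta>\<bar> \<le> 4 * \<bar>real (sel1 u) / real K - 1 / (1 + \<beta>)\<bar>"
        unfolding g_def using sel1_le[of u] K_pos \<beta>_pos \<beta>_le
        by (intro min_max_ratio_complement) (auto simp: divide_simps)
      also have "real (sel1 u) / real K - 1 / (1 + \<beta>) = (real (sel1 u) - real K / (1 + \<beta>)) / real K"
        using K_pos by (simp add: field_simps)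
      finally show ?thesis by (simp add: abs_divide)
    qed
    then show "AE u in utils n. \<bar>g u - \<beta>\<bar> \<le> 4 / real K * \<bar>real (sel1 u) - real K / (1 + \<beta>)\<bar>" by simp
  qed (use sel1_dev in auto)
  also have "\<dots> = 4 / real K * (\<integral>u. \<bar>real (sel1 u) - real K / (1 + \<beta>)\<bar> \<partial>utils n)" by simp
  also have "\<dots> \<le> 4 / real K * (2 * sqrt (real n))"
    using sel1_dev by (intro mult_left_mono) auto
  finally show ?thesis by simp
qed

end

subsection \<open>Utility\<close>

text \<open>Since \<open>N / D\<close> is at most 1, an error in \<open>D\<close> is not amplified
  and only the deterministic \<open>D0\<close> remains as a divisor, however small the random
  \<open>D\<close> is. For \<open>D = 0\<close> also \<open>N = 0\<close>, and the quotient is 0 by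
  convention.\<close>

lemma ratio_perturbation:
  fixes N D N0 D0 :: real
  assumes "0 \<le> N" "N \<le> D" "0 < D0"
  shows "\<bar>N / D - N0 / D0\<bar> \<le> (\<bar>N - N0\<bar> + \<bar>D - D0\<bar>) / D0"
proof (cases "D = 0")
  case True
  then show ?thesis using assms by (simp add: divide_simps)
next
  case False
  then have D: "0 < D" using assms by simp
  have "N / D - N0 / D0 = ((N - N0) - N / D * (D - D0)) / D0"
    using D assms(3) by (simp add: field_simps)
  then have "\<bar>N / D - N0 / D0\<bar> = \<bar>(N - N0) - N / D * (D - D0)\<bar> / D0"
    using assms(3) by simp
  also have "\<dots> \<le> (\<bar>N - N0\<bar> + \<bar>D - D0\<bar>) / D0"
  proof (rule divide_right_mono)
    have "\<bar>N / D * (D - D0)\<bar> \<le> 1 * \<bar>D - D0\<bar>"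
      unfolding abs_mult using D assms by (intro mult_right_mono) auto
    then show "\<bar>(N - N0) - N / D * (D - D0)\<bar> \<le> \<bar>N - N0\<bar> + \<bar>D - D0\<bar>"
      using abs_triangle_ineq4[of "N - N0" "N / D * (D - D0)"] by simp
  qed (use assms in simp)
  finally show ?thesis .
qed

text \<open>Without bias the cutoff is \<open>1 / 2\<close>: of \<open>2 * K\<close> candidates,
  \<open>K\<close> are expected above it, with mean total utility \<open>2 * K * (3 / 8)\<close>.
  Count and sum each deviate by \<open>sqrt n\<close>.\<close>

lemma opt_utility_deviation:
  assumes "K \<le> n" "n = 2 * K"
  obtains d where "integrable (utils n) d" "(\<integral>u. d u \<partial>utils n) \<le> 2 * sqrt (real n)"
    "\<And>u. (\<And>i. i < n \<Longrightarrow> 0 \<le> u i \<and> u i \<le> 1) \<Longrightarrow> \<bar>opt_utility n K u - 3 * real K / 4\<bar> \<le> d u"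
proof -
  define c s where "c u = \<bar>(\<Sum>i<n. indicat_real {1/2<..} (u i)) - real K\<bar>"
    and "s u = \<bar>(\<Sum>i<n. u i * indicat_real {1/2<..} (u i)) - 3 * real K / 4\<bar>" for u :: "nat \<Rightarrow> real"
  have mean: "(\<Sum>i<n. \<integral>x. indicat_real {1/2<..} x \<partial>unif01) = real K"
    using integral_unif01_greaterThan[of "1/2"] assms by simp
  have mean': "(\<Sum>i<n. \<integral>x. x * indicat_real {1/2<..} x \<partial>unif01) = 3 * real K / 4"
    using integral_unif01_id_greaterThan[of "1/2"] assms by (simp add: power2_eq_square)
  have c: "integrable (utils n) c" "(\<integral>u. c u \<partial>utils n) \<le> sqrt (real n)"
    using abs_deviation_sum_le[of "{..<n}" n "\<lambda>i. indicat_real {1/2<..}"]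
    unfolding mean c_def[abs_def] by (auto simp: indicator_def)
  have s: "integrable (utils n) s" "(\<integral>u. s u \<partial>utils n) \<le> sqrt (real n)"
    using abs_deviation_sum_le[of "{..<n}" n "\<lambda>i x. x * indicat_real {1/2<..} x"]
    unfolding mean' s_def[abs_def] by (auto simp: indicator_def)
  show ?thesis
  proof
    show "integrable (utils n) (\<lambda>u. c u + s u)" by (intro Bochner_Integration.integrable_add c s)
    show "(\<integral>u. c u + s u \<partial>utils n) \<le> 2 * sqrt (real n)" using c s by simp
    fix u :: "nat \<Rightarrow> real" assume u: "\<And>i. i < n \<Longrightarrow> 0 \<le> u i \<and> u i \<le> 1"
    have "\<bar>(\<Sum>i\<in>set (take K (rank_list n u)). u i) - (\<Sum>i | i \<in> set (rank_list n u) \<and> 1/2 < u i. u i)\<bar>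
      \<le> \<bar>real (card {i \<in> set (rank_list n u). 1/2 < u i}) - real K\<bar>"
      using u assms by (intro sum_take_threshold_diff) auto
    moreover have "real (card {i \<in> set (rank_list n u). 1/2 < u i}) = (\<Sum>i<n. indicat_real {1/2<..} (u i))"
      by (simp add: indicator_def sum.If_cases Int_def)
    moreover have "(\<Sum>i | i \<in> set (rank_list n u) \<and> 1/2 < u i. u i) = (\<Sum>i<n. u i * indicat_real {1/2<..} (u i))"
      by (simp add: indicator_def sum.If_cases Int_def)
    ultimately have "\<bar>opt_utility n K u - (\<Sum>i<n. u i * indicat_real {1/2<..} (u i))\<bar> \<le> c u"
      unfolding opt_utility_rank_list[OF assms(1)] c_def by simp
    then show "\<bar>opt_utility n K u - 3 * real K / 4\<bar> \<le> c u + s u" by (simp add: s_def)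
  qed
qed

lemma measurable_opt_utility:
  assumes "K \<le> n"
  shows "opt_utility n K \<in> borel_measurable (utils n)"
proof -
  have rl: "rank_list n \<in> utils n \<rightarrow>\<^sub>M count_space UNIV"
    by (intro measurable_rank_list measurable_utils_component)
  have "opt_utility n K u = (\<Sum>i<n. of_bool (i \<in> set (take K (rank_list n u))) * u i)" for u
  proof -
    have "{..<n} \<inter> set (take K (rank_list n u)) = set (take K (rank_list n u))"
      using top_subset by blast
    then show ?thesis
      by (simp add: opt_utility_rank_list[OF assms] of_bool_def if_distrib[where f = "\<lambda>x. x * _"] sum.If_cases
          cong: if_cong)
  qed
  moreover have "(\<lambda>u. \<Sum>i<n. of_bool (i \<in> set (take K (rank_list n u))) * u i) \<in> borel_measurable (utils n)"
  proof (intro borel_measurable_sum borel_measurable_times)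
    fix i
    show "(\<lambda>u. of_bool (i \<in> set (take K (rank_list n u))) :: real) \<in> borel_measurable (utils n)"
      by (rule measurable_compose[OF rl]) simp
  qed (simp add: measurable_utils_component)
  ultimately show ?thesis by (simp cong: measurable_cong)
qed

context selection
begin

text \<open>Origin of the limit: the mean utility above the cutoffs is
  \<open>K / 2 * (1 + 2 * \<beta> / (\<beta> + 1)\<^sup>2)\<close>, and \<open>3 * K / 4\<close> is
  the mean of the optimum.\<close>

lemma utility_mean:
  "(\<Sum>i<n. \<integral>x. x * indicat_real {cutoff i<..} x \<partial>unif01)
    = 3 * real K / 4 * (2 / 3 + 4 * \<beta> / (3 * (\<beta> + 1)\<^sup>2))"
proof -
  have "(\<Sum>i\<in>G1. \<integral>x. x * indicat_real {cutoff i<..} x \<partial>unif01) = (\<Sum>i\<in>G1. (1 - (\<beta> / (1 + \<beta>))\<^sup>2) / 2)"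
    "(\<Sum>i\<in>G2. \<integral>x. x * indicat_real {cutoff i<..} x \<partial>unif01) = (\<Sum>i\<in>G2. (1 - (1 / (1 + \<beta>))\<^sup>2) / 2)"
    by (intro sum.cong refl, simp only: integral_unif01_id_greaterThan[OF cutoff_bounds], simp only: cutoff_G)+
  then have "(\<Sum>i<n. \<integral>x. x * indicat_real {cutoff i<..} x \<partial>unif01)
      = real K * ((1 - (\<beta> / (1 + \<beta>))\<^sup>2) / 2) + real K * ((1 - (1 / (1 + \<beta>))\<^sup>2) / 2)"
    by (simp only: sum_G) (simp add: card_G1 card_G2)
  also have "\<dots> = real K * (2 - (\<beta>\<^sup>2 + 1) / (\<beta> + 1)\<^sup>2) / 2"
    by (simp add: power_divide algebra_simps add_divide_distrib diff_divide_distrib)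
  also have "(\<beta>\<^sup>2 + 1) / (\<beta> + 1)\<^sup>2 = 1 - 2 * \<beta> / (\<beta> + 1)\<^sup>2"
  proof -
    have "\<beta>\<^sup>2 + 1 = (\<beta> + 1)\<^sup>2 - 2 * \<beta>" by (simp add: power2_eq_square algebra_simps)
    then show ?thesis using \<beta>_pos by (simp add: diff_divide_distrib)
  qed
  also have "4 * \<beta> / (3 * (\<beta> + 1)\<^sup>2) = 4 / 3 * (\<beta> / (\<beta> + 1)\<^sup>2)" by simp
  then have "real K * (2 - (1 - 2 * \<beta> / (\<beta> + 1)\<^sup>2)) / 2
      = 3 * real K / 4 * (2 / 3 + 4 * \<beta> / (3 * (\<beta> + 1)\<^sup>2))"
    by (simp add: algebra_simps)
  finally show ?thesis .
qed

lemma utility_bound: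
  "\<bar>utility_metric n K G2 \<beta> unif01 L (A_st n k) - (2 / 3 + 4 * \<beta> / (3 * (\<beta> + 1)\<^sup>2))\<bar>
    \<le> 16 * sqrt (real n) / (3 * real K)"
proof -
  define r where "r = 2 / 3 + 4 * \<beta> / (3 * (\<beta> + 1)\<^sup>2)"
  define D0 where "D0 = 3 * real K / 4"
  have D0: "0 < D0" using K_pos by (simp add: D0_def)
  have Kn: "K \<le> n" using n_eq by simp
  define N where "N u = (\<Sum>i\<in>top u. u i)" for u
  define g where "g u = N u / opt_utility n K u" for u
  define s where "s u = \<bar>(\<Sum>i<n. u i * indicat_real {cutoff i<..} (u i)) - D0 * r\<bar>" for u :: "nat \<Rightarrow> real"
  have s: "integrable (utils n) s" "(\<integral>u. s u \<partial>utils n) \<le> sqrt (real n)"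
    using abs_deviation_sum_le[of "{..<n}" n "\<lambda>i x. x * indicat_real {cutoff i<..} x"]
    unfolding utility_mean s_def[abs_def] D0_def r_def by (auto simp: indicator_def)
  obtain d where d: "integrable (utils n) d" "(\<integral>u. d u \<partial>utils n) \<le> 2 * sqrt (real n)"
    and d_le: "\<And>u. (\<And>i. i < n \<Longrightarrow> 0 \<le> u i \<and> u i \<le> 1) \<Longrightarrow> \<bar>opt_utility n K u - D0\<bar> \<le> d u"
    using opt_utility_deviation[OF Kn n_eq] unfolding D0_def by blast
  have Nsum: "(\<Sum>i\<in>S. u i) = (\<Sum>i<n. of_bool (i \<in> S) * u i)" if "S \<subseteq> {..<n}" for S and u :: "nat \<Rightarrow> real"
    using that by (simp add: of_bool_def if_distrib[where f = "\<lambda>x. x * _"] sum.If_cases Int_absorb1 cong: if_cong)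
  have Nm: "N \<in> borel_measurable (utils n)"
  proof -
    have "(\<lambda>u. \<Sum>i<n. of_bool (i \<in> top u) * u i) \<in> borel_measurable (utils n)"
      unfolding top_def
      by (intro borel_measurable_sum borel_measurable_times measurable_ord_fun measurable_utils_component) auto
    moreover have "N = (\<lambda>u. \<Sum>i<n. of_bool (i \<in> top u) * u i)"
      unfolding N_def[abs_def] by (intro ext Nsum top_props)
    ultimately show ?thesis by simp
  qed
  have gm: "g \<in> borel_measurable (utils n)"
    unfolding g_def[abs_def] by (intro borel_measurable_divide Nm measurable_opt_utility Kn)
  have "utility_metric n K G2 \<beta> unif01 L (A_st n k) = (\<integral>u. g u \<partial>utils n)"
    unfolding utility_metric_def
  proof (rule integral_profile_fst)
    have dom: "dom (A_st n k (est u) \<sigma>) \<subseteq> {..<n}" for u \<sigma>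
      unfolding A_st_eq using dom_serial_assign_subset[of k \<sigma> "ord u"] by simp
    have "(\<lambda>w. (\<Sum>i<n. of_bool (i \<in> dom (A_st n k (est (fst w)) (snd w))) * fst w i) / opt_utility n K (fst w))
        \<in> borel_measurable (utils n \<Otimes>\<^sub>M measure_pmf prefs)"
    proof (intro borel_measurable_divide borel_measurable_sum borel_measurable_times)
      fix i
      show "(\<lambda>w. of_bool (i \<in> dom (A_st n k (est (fst w)) (snd w))) :: real)
          \<in> borel_measurable (utils n \<Otimes>\<^sub>M measure_pmf prefs)"
        using measurable_profile_ord[of "\<lambda>xs \<sigma>. of_bool (i \<in> dom (serial_assign k \<sigma> xs))"]
        unfolding A_st_eq case_prod_unfold .
    next
      fix i assume "i \<in> {..<n}"
      then show "(\<lambda>w. fst w i) \<in> borel_measurable (utils n \<Otimes>\<^sub>M measure_pmf prefs)"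
        by (intro measurable_compose[OF measurable_fst measurable_utils_component]) simp
    next
      show "(\<lambda>w. opt_utility n K (fst w)) \<in> borel_measurable (utils n \<Otimes>\<^sub>M measure_pmf prefs)"
        by (rule measurable_compose[OF measurable_fst measurable_opt_utility[OF Kn]])
    qed
    then show "(\<lambda>(u, \<sigma>). (\<Sum>i\<in>dom (A_st n k (est u) \<sigma>). u i) / opt_utility n K u)
        \<in> borel_measurable (utils n \<Otimes>\<^sub>M measure_pmf prefs)"
      unfolding case_prod_unfold Nsum[OF dom] .
  next
    show "g \<in> borel_measurable (utils n)" by (rule gm)
  next
    fix u \<sigma> assume "\<sigma> \<in> set_pmf prefs"
    then show "(case (u, \<sigma>) of (u, \<sigma>) \<Rightarrow> (\<Sum>i\<in>dom (A_st n k (est u) \<sigma>). u i) / opt_utility n K u) = g u"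
      by (simp add: dom_A_st g_def N_def)
  qed
  also have "\<bar>\<dots> - r\<bar> \<le> (\<integral>u. (count_dev u + s u + d u) / D0 \<partial>utils n)"
  proof (rule integral_dist_le[OF gm])
    show "integrable (utils n) (\<lambda>u. (count_dev u + s u + d u) / D0)"
      using count_dev(1) s(1) d(1) by simp
    show "AE u in utils n. \<bar>g u - r\<bar> \<le> (count_dev u + s u + d u) / D0"
    proof (rule eventually_mono[OF AE_utils_bounds])
      fix u :: "nat \<Rightarrow> real" assume u: "\<forall>i<n. 0 \<le> u i \<and> u i \<le> 1"
      have N0: "0 \<le> N u"
        unfolding N_def using u top_props(1)[of u] by (intro sum_nonneg) auto
      have NO: "N u \<le> opt_utility n K u"
        unfolding N_def opt_utility_rank_list[OF Kn] by (intro sum_le_sum_top top_props)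
      have "\<bar>N u - (\<Sum>i<n. u i * indicator {cutoff i<..} (u i))\<bar> \<le> count_dev u"
        unfolding N_def using u by (intro top_sum_diff) auto
      then have "\<bar>N u - D0 * r\<bar> \<le> count_dev u + s u" by (simp add: s_def)
      moreover have "\<bar>opt_utility n K u - D0\<bar> \<le> d u" using u by (intro d_le) auto
      ultimately have "(\<bar>N u - D0 * r\<bar> + \<bar>opt_utility n K u - D0\<bar>) / D0 \<le> (count_dev u + s u + d u) / D0"
        using D0 by (intro divide_right_mono) auto
      with ratio_perturbation[OF N0 NO D0, of "D0 * r"] D0
      show "\<bar>g u - r\<bar> \<le> (count_dev u + s u + d u) / D0" by (simp add: g_def)
    qed
  qed
  also have "(\<integral>u. (count_dev u + s u + d u) / D0 \<partial>utils n)
      = ((\<integral>u. count_dev u \<partial>utils n) + (\<integral>u. s u \<partial>utils n) + (\<integral>u. d u \<partial>utils n)) / D0"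
    using count_dev(1) s(1) d(1) by simp
  \<comment> \<open>The 4 collects 1 for the count, 1 for the sum above the cutoffs and 2 for the
    optimum.\<close>
  also have "\<dots> \<le> (4 * sqrt (real n)) / D0"
    using count_dev(2) s(2) d(2) D0 by (intro divide_right_mono) auto
  also have "\<dots> = 16 * sqrt (real n) / (3 * real K)"
    by (simp add: D0_def)
  finally show ?thesis unfolding r_def .
qed

end

subsection \<open>Preference\<close>

lemma of_bool_divide_bounds:
  "0 \<le> of_bool P / real m" "of_bool P / real m \<le> 1"
  by (cases m; simp)+

lemma integrable_pmf_bounded:
  fixes f :: "'a \<Rightarrow> real"
  assumes "\<And>x. 0 \<le> f x \<and> f x \<le> B"
  shows "integrable (measure_pmf P) f"
  using assms by (intro measure_pmf.integrable_const_bound[where B = B]) auto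

text \<open>Without ties the order is determined by the values alone, so exchanging two values
  relabels it. Ties would be resolved by index, which a relabelling does not respect.\<close>

lemma rank_list_transpose:
  assumes inj: "inj_on v {..<n}" and ij: "i < n" "j < n"
    and v': "\<And>l. l < n \<Longrightarrow> v' l = v (Transposition.transpose i j l)"
  shows "rank_list n v' = map (Transposition.transpose i j) (rank_list n v)"
proof (rule map_sorted_distinct_set_unique[where f = "\<lambda>l. - v' l"])
  let ?\<tau> = "Transposition.transpose i j"
  have \<tau>: "?\<tau> l < n" if "l < n" for l using that ij by (auto simp: Transposition.transpose_def)
  have img: "?\<tau> ` {..<n} = {..<n}"
    using ij by (simp add: transpose_image_eq)
  have inj': "inj_on (\<lambda>l. - v' l) {..<n}"
  proof (rule inj_onI)
    fix a b assume ab: "a \<in> {..<n}" "b \<in> {..<n}" "- v' a = - v' b"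
    then have "v (?\<tau> a) = v (?\<tau> b)" by (simp add: v')
    then have "?\<tau> a = ?\<tau> b" using inj ab \<tau> by (auto dest: inj_onD)
    then have "?\<tau> (?\<tau> a) = ?\<tau> (?\<tau> b)" by (rule arg_cong)
    then show "a = b" by simp
  qed
  show "inj_on (\<lambda>l. - v' l) (set (rank_list n v') \<union> set (map ?\<tau> (rank_list n v)))"
    using inj' img by simp
  show "distinct (map (\<lambda>l. - v' l) (rank_list n v'))"
    using inj' by (simp add: distinct_map)
  have eq: "map (\<lambda>l. - v' l) (map ?\<tau> (rank_list n v)) = map (\<lambda>l. - v l) (rank_list n v)"
    using \<tau> by (auto simp: v')
  show "sorted (map (\<lambda>l. - v' l) (map ?\<tau> (rank_list n v)))"
    unfolding eq by simp
  have "inj_on (\<lambda>l. - v l) {..<n}" using inj by (auto simp: inj_on_def)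
  then show "distinct (map (\<lambda>l. - v' l) (map ?\<tau> (rank_list n v)))"
    unfolding eq by (simp add: distinct_map)
  show "set (rank_list n v') = set (map ?\<tau> (rank_list n v))"
    using img by simp
qed simp

context selection
begin

abbreviation recs :: "(nat \<Rightarrow> real) \<Rightarrow> (nat \<Rightarrow> nat list) \<Rightarrow> nat set" where
  "recs u \<sigma> \<equiv> receivers k \<sigma> (ord u)"

text \<open>
  If the candidate considered first belongs to \<open>G1\<close>, then it receives its first choice. Leaving it
  out compensates for counting \<open>i\<close> among the rivals, so that the shares of all \<open>i \<in> G2\<close> add up
  to \<open>X / Y\<close>, while \<open>i\<close> has become indistinguishable from a member of \<open>G1\<close>.
\<close>

definition rivals :: "nat \<Rightarrow> nat list \<Rightarrow> nat set" where
  "rivals i xs = insert i G1 - {hd xs}"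

definition share :: "nat \<Rightarrow> nat list \<Rightarrow> (nat \<Rightarrow> nat list) \<Rightarrow> real" where
  "share i xs \<sigma> = of_bool (i \<in> receivers k \<sigma> xs) / real (card (rivals i xs \<inter> receivers k \<sigma> xs))"

definition mean_share :: "nat \<Rightarrow> (nat \<Rightarrow> real) \<Rightarrow> real" where
  "mean_share i u = (\<integral>\<sigma>. share i (ord u) \<sigma> \<partial>measure_pmf prefs)"

definition top_rivals :: "nat \<Rightarrow> (nat \<Rightarrow> real) \<Rightarrow> nat" where
  "top_rivals i u = card (rivals i (ord u) \<inter> top u)"

definition top_share :: "nat \<Rightarrow> (nat \<Rightarrow> real) \<Rightarrow> real" where
  "top_share i u = of_bool (i \<in> top u) / real (top_rivals i u)"

text \<open>Estimated utilities in \<open>G2\<close> are almost surely at most \<beta>, so this puts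
  a member of \<open>G1\<close> first in the order, and one that is not \<open>low\<close> and hence
  stays in place under every exchange.\<close>

definition leading :: "(nat \<Rightarrow> real) \<Rightarrow> bool" where
  "leading u \<longleftrightarrow> (\<exists>j\<in>G1. \<beta> < u j)"

text \<open>
  The weight excludes profiles with an untypically small number of assigned members of \<open>G1\<close>. It is
  expressed by the rivals because it has to be invariant under the exchange of \<open>i\<close> with a low
  member of \<open>G1\<close>.
\<close>

definition weight :: "nat \<Rightarrow> (nat \<Rightarrow> real) \<Rightarrow> real" where
  "weight i u = of_bool (leading u \<and> K \<le> 4 * top_rivals i u)"

definition low :: "(nat \<Rightarrow> real) \<Rightarrow> nat set" where
  "low u = {j \<in> G1. u j \<le> \<beta>}"

definition generic :: "(nat \<Rightarrow> real) \<Rightarrow> bool" where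
  "generic u \<longleftrightarrow> inj_on (est u) {..<n} \<and> (\<forall>i<n. 0 \<le> u i \<and> u i \<le> 1)"

lemma share_bounds: "0 \<le> share i xs \<sigma>" "share i xs \<sigma> \<le> 1"
  unfolding share_def by (rule of_bool_divide_bounds)+

lemma top_share_bounds: "0 \<le> top_share i u" "top_share i u \<le> 1"
  unfolding top_share_def by (rule of_bool_divide_bounds)+

lemma integrable_share: "integrable (measure_pmf prefs) (share i xs)"
  using share_bounds by (intro integrable_pmf_bounded) blast

lemma mean_share_bounds: "0 \<le> mean_share i u" "mean_share i u \<le> 1"
proof -
  show "0 \<le> mean_share i u"
    unfolding mean_share_def by (intro integral_nonneg_AE) (simp add: share_bounds)
  have "mean_share i u \<le> (\<integral>\<sigma>. 1 \<partial>measure_pmf prefs)"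
    unfolding mean_share_def by (intro integral_mono integrable_share share_bounds) simp
  then show "mean_share i u \<le> 1" by simp
qed

lemma AE_generic: "AE u in utils n. generic u"
proof -
  define c where "c i = (if i \<in> G2 then \<beta> else 1)" for i
  have est: "est u i = c i * u i" for u i by (simp add: c_def est_utility_def)
  have neq: "AE u in utils n. i \<noteq> j \<longrightarrow> est u i \<noteq> est u j" if "i \<in> {..<n}" "j \<in> {..<n}" for i j
  proof (cases "i = j")
    case False
    have "AE u in utils n. c i * u i \<noteq> c j * u j"
      using that False \<beta>_pos by (intro AE_utils_neq) (auto simp: c_def)
    then show ?thesis unfolding est by (rule eventually_mono) simp
  qed simp
  have "AE u in utils n. \<forall>i\<in>{..<n}. \<forall>j\<in>{..<n}. i \<noteq> j \<longrightarrow> est u i \<noteq> est u j"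
    by (intro AE_finite_allI neq finite_lessThan)
  with AE_utils_bounds[of n] show ?thesis
  proof eventually_elim
    case (elim u)
    have "inj_on (est u) {..<n}"
      by (rule inj_onI) (use elim(2) in blast)
    with elim(1) show ?case by (simp add: generic_def)
  qed
qed

lemma est_G: "i \<in> G1 \<Longrightarrow> est u i = u i" "i \<in> G2 \<Longrightarrow> est u i = \<beta> * u i"
  using G_Int by (auto simp: est_utility_def)

lemma generic_G2_le:
  assumes "generic u" "i \<in> G2"
  shows "est u i \<le> \<beta>"
  using assms \<beta>_pos G_less(2)[of i] by (simp add: est_G generic_def)

lemma ord_ne: "ord u \<noteq> []"
  using n_eq K_pos by (metis length_0_conv rank_list_simps(3) mult_eq_0_iff not_one_le_zero zero_neq_numeral)

lemma hd_ord: "hd (ord u) < n" "hd (ord u) \<in> top u" "i < n \<Longrightarrow> est u i \<le> est u (hd (ord u))"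
proof -
  obtain x xs where x: "ord u = x # xs" using ord_ne by (cases "ord u") auto
  have s: "sorted (map (\<lambda>i. - est u i) (x # xs))" using rank_list_simps(4)[of "est u" n] x by simp
  have set: "set (x # xs) = {..<n}" using rank_list_simps(1)[of n "est u"] x by simp
  show "hd (ord u) < n" using set x by auto
  have "take K (ord u) \<noteq> []" using x K_pos by simp
  then have "hd (take K (ord u)) \<in> top u" unfolding top_def by (rule hd_in_set)
  then show "hd (ord u) \<in> top u" using K_pos by (simp add: hd_take)
  show "i < n \<Longrightarrow> est u i \<le> est u (hd (ord u))" using s set x by fastforce
qed

lemma hd_ord_leading:
  assumes "generic u" "leading u"
  shows "hd (ord u) \<in> G1" "hd (ord u) \<notin> low u"
proof -
  obtain j where j: "j \<in> G1" "\<beta> < u j" using assms by (auto simp: leading_def)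
  then have gt: "\<beta> < est u (hd (ord u))"
    using hd_ord(3)[of j u] G_less by (simp add: est_G)
  then have "hd (ord u) \<notin> G2" using generic_G2_le[OF assms(1)] by fastforce
  then show "hd (ord u) \<in> G1" using hd_ord(1)[of u] G_Un by auto
  then show "hd (ord u) \<notin> low u" using gt by (auto simp: low_def est_G)
qed

lemma sorted_ord: "sorted_wrt (\<lambda>a b. est u b \<le> est u a) (ord u)"
  using rank_list_simps(4)[of "est u" n] by (simp add: sorted_map)

text \<open>For fixed utilities, \<open>i\<close> and the candidates it can be exchanged with form
  the late group of \<open>expectation_late_fraction_le\<close>.\<close>

lemma mean_share_average:
  assumes u: "generic u" "leading u" and i: "i \<in> G2"
  shows "(\<Sum>j\<in>insert i (low u). \<integral>\<sigma>. of_bool (j \<in> recs u \<sigma>) / real (card (rivals i (ord u) \<inter> recs u \<sigma>)) \<partial>measure_pmf prefs)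
    \<le> (\<Sum>j\<in>insert i (low u). of_bool (j \<in> top u) / real (top_rivals i u))"
proof -
  \<comment> \<open>All of \<open>P1\<close> lies above \<beta> and all of \<open>P2\<close> at or
    below it, which gives the required order. The leader is omitted so that the union is
    \<open>rivals i (ord u)\<close>.\<close>
  define P2 where "P2 = insert i (low u)"
  define P1 where "P1 = G1 - low u - {hd (ord u)}"
  have fin: "finite P2" by (simp add: P2_def low_def)
  have iG: "i \<notin> G1" using i G_Int by auto
  have disj: "P1 \<inter> P2 = {}" using iG by (auto simp: P1_def P2_def)
  have "hd (ord u) \<notin> P2"
    using hd_ord_leading[OF u] i G_Int by (auto simp: P2_def)
  then have un: "P1 \<union> P2 = rivals i (ord u)"
    by (auto simp: P1_def P2_def rivals_def low_def)
  have "sorted_wrt (\<lambda>a b. \<not> (a \<in> P2 \<and> b \<in> P1)) (ord u)"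
  proof (rule sorted_wrt_mono_rel[OF _ sorted_ord])
    fix a b assume ab: "est u b \<le> est u a"
    show "\<not> (a \<in> P2 \<and> b \<in> P1)"
    proof
      assume "a \<in> P2 \<and> b \<in> P1"
      then have "est u a \<le> \<beta>" "\<beta> < est u b"
        using generic_G2_le[OF u(1)] i by (auto simp: P1_def P2_def low_def est_G)
      with ab show False by simp
    qed
  qed
  from expectation_late_fraction_le[OF L_perm p_pos _ this disj, of k]
  have le: "(\<integral>\<sigma>. real (card (P2 \<inter> recs u \<sigma>)) / real (card (rivals i (ord u) \<inter> recs u \<sigma>)) \<partial>measure_pmf prefs)
      \<le> real (card (P2 \<inter> top u)) / real (top_rivals i u)"
    by (simp only: un rank_list_simps(1,2) top_rivals_def top_def K_eq[symmetric])
  have sum: "(\<Sum>j\<in>P2. of_bool (j \<in> S) / c) = real (card (P2 \<inter> S)) / c" for S and c :: real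
    using fin by (simp add: sum_divide_distrib[symmetric])
  have "(\<Sum>j\<in>P2. \<integral>\<sigma>. of_bool (j \<in> recs u \<sigma>) / real (card (rivals i (ord u) \<inter> recs u \<sigma>)) \<partial>measure_pmf prefs)
      = (\<integral>\<sigma>. (\<Sum>j\<in>P2. of_bool (j \<in> recs u \<sigma>) / real (card (rivals i (ord u) \<inter> recs u \<sigma>))) \<partial>measure_pmf prefs)"
    by (intro Bochner_Integration.integral_sum[symmetric] integrable_pmf_bounded[where B = 1])
      (simp only: of_bool_divide_bounds simp_thms)
  also have "\<dots> \<le> (\<Sum>j\<in>P2. of_bool (j \<in> top u) / real (top_rivals i u))"
    unfolding sum by (rule le)
  finally show ?thesis by (simp add: P2_def)
qed

text \<open>Rankings are i.i.d.; this lets the preferences move along with the exchanged candidates,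
  so that the whole run is merely relabelled.\<close>

lemma expectation_prefs_transpose:
  fixes f :: "(nat \<Rightarrow> nat list) \<Rightarrow> real"
  assumes "i < n" "j < n"
  shows "(\<integral>\<sigma>. f \<sigma> \<partial>measure_pmf prefs) = (\<integral>\<sigma>. f (\<lambda>l. \<sigma> (Transposition.transpose i j l)) \<partial>measure_pmf prefs)"
proof -
  have "bij_betw (Transposition.transpose i j) {..<n} {..<n}"
    using assms by (intro bij_betw_imageI inj_on_subset[OF inj_on_transpose subset_UNIV] transpose_image_eq) simp
  then have "prefs = map_pmf (\<lambda>\<sigma>. \<sigma> \<circ> Transposition.transpose i j) prefs"
    using assms by (intro Pi_pmf_bij_betw) (auto simp: Transposition.transpose_def)
  then have "(\<integral>\<sigma>. f \<sigma> \<partial>measure_pmf prefs)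
      = (\<integral>\<sigma>. f \<sigma> \<partial>measure_pmf (map_pmf (\<lambda>\<sigma>. \<sigma> \<circ> Transposition.transpose i j) prefs))"
    by (rule arg_cong[where f = "\<lambda>P. integral\<^sup>L (measure_pmf P) f"])
  then show ?thesis by (simp add: o_def)
qed

text \<open>After the exchange \<open>i\<close> plays the part of \<open>j\<close> in the original
  run, while everything that is symmetric on \<open>insert i G1\<close> stays the same. That
  \<open>j\<close> remains low uses \<open>u i \<le> 1\<close>.\<close>

lemma swap_covariance:
  assumes u: "generic u" and i: "i \<in> G2" and j: "j \<in> G1" "u j \<le> \<beta>"
  defines "u' \<equiv> swap_utils \<beta> i j u"
  shows "mean_share i u'
      = (\<integral>\<sigma>. of_bool (j \<in> recs u \<sigma>) / real (card (rivals i (ord u) \<inter> recs u \<sigma>)) \<partial>measure_pmf prefs)"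
    and "top_share i u' = of_bool (j \<in> top u) / real (top_rivals i u)"
    and "weight i u' = weight i u" and "low u' = low u"
proof -
  let ?\<tau> = "Transposition.transpose i j"
  have ij: "i < n" "j < n" "i \<noteq> j" using i j G_less G_Int by auto
  have jG: "j \<notin> G2" "i \<notin> G1" using i j G_Int by auto
  have u'l: "u' i = u j / \<beta>" "u' j = \<beta> * u i" "\<And>l. l \<noteq> i \<Longrightarrow> l \<noteq> j \<Longrightarrow> u' l = u l"
    using ij by (auto simp: u'_def swap_utils_def)
  have e: "est u' l = est u (?\<tau> l)" for l
    using jG i \<beta>_pos u'l by (cases "l = i"; cases "l = j") (auto simp: est_utility_def)
  have ord': "ord u' = map ?\<tau> (ord u)"
    using u ij e by (intro rank_list_transpose) (auto simp: generic_def)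
  have top': "top u' = ?\<tau> ` top u"
    by (simp add: top_def ord' take_map)
  have mem: "i \<in> ?\<tau> ` S \<longleftrightarrow> j \<in> S" for S
    by (metis inj_image_mem_iff inj_transpose transpose_apply_second)
  have riv: "rivals i (ord u') = ?\<tau> ` rivals i (ord u)"
  proof -
    have "?\<tau> ` insert i G1 = insert i G1"
      using j by (intro transpose_image_eq) simp
    moreover have "hd (ord u') = ?\<tau> (hd (ord u))"
      using ord_ne by (simp add: ord' hd_map)
    ultimately show ?thesis by (simp add: rivals_def image_set_diff)
  qed
  have cardI: "card (?\<tau> ` A \<inter> ?\<tau> ` B) = card (A \<inter> B)" for A B
    by (subst image_Int[symmetric, OF inj_on_transpose], rule card_image[OF inj_on_subset[OF inj_on_transpose subset_UNIV]])
  have tr: "top_rivals i u' = top_rivals i u"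
    by (simp add: top_rivals_def riv top' cardI)
  have "mean_share i u' = (\<integral>\<sigma>. share i (ord u') (\<lambda>l. \<sigma> (?\<tau> l)) \<partial>measure_pmf prefs)"
    unfolding mean_share_def by (rule expectation_prefs_transpose[OF ij(1,2)])
  also have "(\<lambda>\<sigma>. share i (ord u') (\<lambda>l. \<sigma> (?\<tau> l)))
      = (\<lambda>\<sigma>. of_bool (j \<in> recs u \<sigma>) / real (card (rivals i (ord u) \<inter> recs u \<sigma>)))"
  proof
    fix \<sigma>
    have "receivers k (\<lambda>l. \<sigma> (?\<tau> l)) (ord u') = ?\<tau> ` recs u \<sigma>"
      unfolding ord' by (rule receivers_map) simp
    then show "share i (ord u') (\<lambda>l. \<sigma> (?\<tau> l)) = of_bool (j \<in> recs u \<sigma>) / real (card (rivals i (ord u) \<inter> recs u \<sigma>))"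
      by (simp only: share_def riv cardI mem)
  qed
  finally show "mean_share i u'
      = (\<integral>\<sigma>. of_bool (j \<in> recs u \<sigma>) / real (card (rivals i (ord u) \<inter> recs u \<sigma>)) \<partial>measure_pmf prefs)" .
  show "top_share i u' = of_bool (j \<in> top u) / real (top_rivals i u)"
    by (simp only: top_share_def tr top' mem)
  have ui: "u' j \<le> \<beta>"
    using u'l u ij \<beta>_pos by (simp add: generic_def)
  have le: "u' l \<le> \<beta> \<longleftrightarrow> u l \<le> \<beta>" if "l \<in> G1" for l
  proof (cases "l = j")
    case False
    moreover have "l \<noteq> i" using that jG by auto
    ultimately show ?thesis using u'l(3)[of l] by simp
  qed (use ui j in simp)
  then show "low u' = low u" by (auto simp: low_def)
  have "leading u' = leading u" using le by (auto simp: leading_def not_le[symmetric])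
  then show "weight i u' = weight i u" by (simp add: weight_def tr)
qed

lemma measurable_leading: "Measurable.pred (utils n) leading"
proof -
  have "{u \<in> space (utils n). \<exists>j\<in>G1. \<beta> < u j} = (\<Union>j\<in>G1. {u \<in> space (utils n). \<beta> < u j})" by auto
  moreover have "{u \<in> space (utils n). \<beta> < u j} \<in> sets (utils n)" if "j \<in> G1" for j
  proof -
    note [measurable] = measurable_utils_component[OF G_less(1)[OF that]]
    show ?thesis by measurable
  qed
  ultimately show ?thesis
    unfolding pred_def leading_def[abs_def] by (auto intro!: sets.finite_UN)
qed

lemma measurable_weight: "weight i \<in> borel_measurable (utils n)"
proof -
  note [measurable] = measurable_leading
  have [measurable]: "(\<lambda>u. of_bool (K \<le> 4 * top_rivals i u) :: real) \<in> borel_measurable (utils n)"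
    unfolding top_rivals_def top_def by (rule measurable_ord_fun)
  have "weight i = (\<lambda>u. (if leading u then 1 else 0) * of_bool (K \<le> 4 * top_rivals i u))"
    by (auto simp: weight_def)
  then show ?thesis by simp
qed

lemma card_low: "real (card (low u)) = (\<Sum>j\<in>G1. indicat_real {u. u j \<le> \<beta>} u)"
  by (simp add: low_def indicator_def sum.If_cases Int_def)

lemma measurable_low_ind: "j \<in> G1 \<Longrightarrow> (\<lambda>u. indicat_real {u. u j \<le> \<beta>} u) \<in> borel_measurable (utils n)"
proof -
  assume "j \<in> G1"
  note [measurable] = measurable_utils_component[OF G_less(1)[OF this]]
  show ?thesis unfolding indicator_def mem_Collect_eq by measurable
qed

text \<open>The inequality fails pointwise, for a single \<open>i\<close>, but holds after summing
  over \<open>i\<close> and \<open>low u\<close>. Exchanging utilities under the integral turns the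
  term of \<open>i\<close> into that of each \<open>j\<close>, which produces this sum.\<close>

lemma mean_share_le_top_share:
  assumes i: "i \<in> G2"
  shows "(\<integral>u. mean_share i u * weight i u \<partial>utils n) \<le> (\<integral>u. top_share i u * weight i u \<partial>utils n)"
proof -
  define D where "D u = mean_share i u * weight i u - top_share i u * weight i u" for u
  \<comment> \<open>The divisor counts \<open>i\<close> and its exchange partners and is invariant
    under each exchange. So \<open>D u\<close> splits into equal parts \<open>h u\<close>, one for
    \<open>i\<close> and one per low \<open>j\<close>, and each part is exchanged with its own
    \<open>j\<close>.\<close>
  define h where "h u = D u / (real (card (low u)) + 1)" for u
  have msm: "mean_share i \<in> borel_measurable (utils n)" and tsm: "top_share i \<in> borel_measurable (utils n)"
    unfolding mean_share_def[abs_def] top_share_def[abs_def] top_rivals_def top_def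
    by (rule measurable_ord_fun)+
  note [measurable] = msm tsm measurable_weight measurable_low_ind
  have Dm [measurable]: "D \<in> borel_measurable (utils n)" unfolding D_def[abs_def] by measurable
  have hm [measurable]: "h \<in> borel_measurable (utils n)" unfolding h_def[abs_def] card_low by measurable
  have w: "0 \<le> weight i u" "weight i u \<le> 1" for u by (simp_all add: weight_def)
  have int_ms: "integrable (utils n) (\<lambda>u. mean_share i u * weight i u)"
    by (rule utils.integrable_const_bound[where B = 1])
      (auto simp: w mean_share_bounds intro!: mult_le_one)
  have int_ts: "integrable (utils n) (\<lambda>u. top_share i u * weight i u)"
    by (rule utils.integrable_const_bound[where B = 1])
      (auto simp: w top_share_bounds intro!: mult_le_one)
  have Db: "\<bar>D u\<bar> \<le> 1" for u
  proof -
    have "0 \<le> mean_share i u * weight i u \<and> mean_share i u * weight i u \<le> 1"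
      "0 \<le> top_share i u * weight i u \<and> top_share i u * weight i u \<le> 1"
      by (simp_all add: w mean_share_bounds top_share_bounds mult_le_one)
    then show ?thesis unfolding D_def by linarith
  qed
  have hb: "\<bar>h u\<bar> \<le> 1" for u
    using Db[of u] by (simp add: h_def divide_simps)
  have int_h: "integrable (utils n) (\<lambda>u. indicat_real {u. u j \<le> \<beta>} u * h (f u))"
    if "j \<in> G1" "f \<in> utils n \<rightarrow>\<^sub>M utils n" for j f
  proof (rule utils.integrable_const_bound[where B = 1])
    show "(\<lambda>u. indicat_real {u. u j \<le> \<beta>} u * h (f u)) \<in> borel_measurable (utils n)"
      by (intro borel_measurable_times measurable_low_ind that measurable_compose[OF that(2) hm])
  qed (auto simp: indicator_def hb)
  have int_h1: "integrable (utils n) h"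
    by (rule utils.integrable_const_bound[where B = 1]) (auto simp: hb)
  note sw = measurable_swap_utils[OF G_less(2)[OF i] G_less(1)]
  have D_eq: "D u = (\<Sum>j\<in>G1. indicat_real {u. u j \<le> \<beta>} u * h u) + h u" for u
  proof -
    have "(\<Sum>j\<in>G1. indicat_real {u. u j \<le> \<beta>} u * h u) + h u = (real (card (low u)) + 1) * h u"
      by (simp add: card_low sum_distrib_right[symmetric] distrib_right)
    then show ?thesis by (simp add: h_def)
  qed
  have int_split: "(\<integral>u. (\<Sum>j\<in>G1. indicat_real {u. u j \<le> \<beta>} u * h (f j u)) + h u \<partial>utils n)
      = (\<Sum>j\<in>G1. \<integral>u. indicat_real {u. u j \<le> \<beta>} u * h (f j u) \<partial>utils n) + (\<integral>u. h u \<partial>utils n)"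
    if f: "\<And>j. j \<in> G1 \<Longrightarrow> f j \<in> utils n \<rightarrow>\<^sub>M utils n" for f
  proof -
    have "integrable (utils n) (\<lambda>u. \<Sum>j\<in>G1. indicat_real {u. u j \<le> \<beta>} u * h (f j u))"
      by (intro Bochner_Integration.integrable_sum int_h f)
    then have "(\<integral>u. (\<Sum>j\<in>G1. indicat_real {u. u j \<le> \<beta>} u * h (f j u)) + h u \<partial>utils n)
      = (\<integral>u. (\<Sum>j\<in>G1. indicat_real {u. u j \<le> \<beta>} u * h (f j u)) \<partial>utils n) + (\<integral>u. h u \<partial>utils n)"
      by (rule Bochner_Integration.integral_add[OF _ int_h1])
    also have "(\<integral>u. (\<Sum>j\<in>G1. indicat_real {u. u j \<le> \<beta>} u * h (f j u)) \<partial>utils n)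
        = (\<Sum>j\<in>G1. \<integral>u. indicat_real {u. u j \<le> \<beta>} u * h (f j u) \<partial>utils n)"
      by (rule Bochner_Integration.integral_sum) (intro int_h f)
    finally show ?thesis .
  qed
  have "(\<integral>u. D u \<partial>utils n) = (\<Sum>j\<in>G1. \<integral>u. indicat_real {u. u j \<le> \<beta>} u * h u \<partial>utils n) + (\<integral>u. h u \<partial>utils n)"
    unfolding D_eq by (rule int_split[of "\<lambda>_ u. u"]) simp
  also have "(\<Sum>j\<in>G1. \<integral>u. indicat_real {u. u j \<le> \<beta>} u * h u \<partial>utils n)
      = (\<Sum>j\<in>G1. \<integral>u. indicat_real {u. u j \<le> \<beta>} u * h (swap_utils \<beta> i j u) \<partial>utils n)"
  proof (rule sum.cong[OF refl])
    fix j assume j: "j \<in> G1"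
    then have "i \<noteq> j" using i G_Int by auto
    then show "(\<integral>u. indicat_real {u. u j \<le> \<beta>} u * h u \<partial>utils n)
        = (\<integral>u. indicat_real {u. u j \<le> \<beta>} u * h (swap_utils \<beta> i j u) \<partial>utils n)"
      by (intro integral_swap_utils[symmetric] G_less i j \<beta>_pos \<beta>_le hm)
  qed
  also have "\<dots> + (\<integral>u. h u \<partial>utils n)
      = (\<integral>u. (\<Sum>j\<in>G1. indicat_real {u. u j \<le> \<beta>} u * h (swap_utils \<beta> i j u)) + h u \<partial>utils n)"
    by (rule int_split[OF sw, symmetric])
  also have "\<dots> \<le> (\<integral>u. 0 \<partial>utils n)"
  proof (rule integral_mono_AE)
    show "integrable (utils n) (\<lambda>u. (\<Sum>j\<in>G1. indicat_real {u. u j \<le> \<beta>} u * h (swap_utils \<beta> i j u)) + h u)"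
      using int_h[OF _ sw] int_h1
      by (intro Bochner_Integration.integrable_add Bochner_Integration.integrable_sum) auto
    show "AE u in utils n. (\<Sum>j\<in>G1. indicat_real {u. u j \<le> \<beta>} u * h (swap_utils \<beta> i j u)) + h u \<le> 0"
    proof (rule eventually_mono[OF AE_generic])
      fix u assume u: "generic u"
      define f where "f j = (\<integral>\<sigma>. of_bool (j \<in> recs u \<sigma>) / real (card (rivals i (ord u) \<inter> recs u \<sigma>)) \<partial>measure_pmf prefs)
          - of_bool (j \<in> top u) / real (top_rivals i u)" for j
      define w where "w = weight i u / (real (card (low u)) + 1)"
      have hj: "h (swap_utils \<beta> i j u) = f j * w" if "j \<in> low u" for j
        using swap_covariance[OF u i, of j] that
        by (simp add: h_def D_def f_def w_def low_def[of u] left_diff_distrib)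
      have hi: "h u = f i * w"
        by (simp add: h_def D_def f_def w_def mean_share_def share_def top_share_def left_diff_distrib)
      have inotin: "i \<notin> low u" using i G_Int by (auto simp: low_def)
      have finlow: "finite (low u)" by (simp add: low_def)
      have "(\<Sum>j\<in>G1. indicat_real {u. u j \<le> \<beta>} u * h (swap_utils \<beta> i j u)) = (\<Sum>j\<in>low u. h (swap_utils \<beta> i j u))"
        by (simp add: low_def indicator_def if_distrib[where f = "\<lambda>x. x * _"] sum.If_cases Int_def cong: if_cong)
      also have "\<dots> + h u = (\<Sum>j\<in>insert i (low u). f j) * w"
        using inotin finlow by (simp add: hj hi sum_distrib_right distrib_right)
      also have "\<dots> \<le> 0"
      proof (cases "leading u")
        case True
        have "(\<Sum>j\<in>insert i (low u). f j) \<le> 0"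
          unfolding f_def sum_subtractf using mean_share_average[OF u True i] by simp
        moreover have "0 \<le> w" by (simp add: w_def weight_def)
        ultimately show ?thesis by (rule mult_nonpos_nonneg)
      qed (simp add: w_def weight_def)
      finally show "(\<Sum>j\<in>G1. indicat_real {u. u j \<le> \<beta>} u * h (swap_utils \<beta> i j u)) + h u \<le> 0" .
    qed
  qed simp
  finally have "(\<integral>u. D u \<partial>utils n) \<le> 0" by simp
  then show ?thesis unfolding D_def using int_ms int_ts by simp
qed

end

section \<open>From the averaged shares to the preference metric\<close>

context selection
begin

lemma top_rivals_eq:
  assumes u: "generic u" "leading u" and i: "i \<in> G2" "i \<in> top u"
  shows "top_rivals i u = sel1 u"
proof -
  have "i \<notin> G1" using i G_Int by auto
  then have "rivals i (ord u) \<inter> top u = insert i ((G1 \<inter> top u) - {hd (ord u)})"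
    using i hd_ord_leading[OF u] by (auto simp: rivals_def)
  moreover have "i \<notin> (G1 \<inter> top u) - {hd (ord u)}" using \<open>i \<notin> G1\<close> by simp
  moreover have "Suc (card ((G1 \<inter> top u) - {hd (ord u)})) = card (G1 \<inter> top u)"
    using hd_ord_leading(1)[OF u] hd_ord(2)[of u] by (intro card_Suc_Diff1) auto
  ultimately show ?thesis
    unfolding top_rivals_def sel1_def
    by (simp only: card_insert_disjoint finite_Diff finite_Int finite_G simp_thms)
qed

text \<open>With \<open>a = sel1 u\<close>, the sum is \<open>(K - a) / a\<close> where the weights
  are active, and this equals \<beta> at \<open>a = K / (1 + \<beta>)\<close>. Elsewhere every term
  vanishes, by its weight or because \<open>i\<close> is not assigned.\<close>

lemma sum_top_share_le:
  assumes u: "generic u"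
  shows "(\<Sum>i\<in>G2. top_share i u * weight i u) \<le> \<beta> + 8 / real K * \<bar>real (sel1 u) - real K / (1 + \<beta>)\<bar>"
proof (cases "leading u \<and> K \<le> 4 * sel1 u")
  case True
  define a where "a = real (sel1 u)"
  have a: "real K \<le> 4 * a" "0 < a" using True K_pos unfolding a_def by linarith+
  have "(\<Sum>i\<in>G2. top_share i u * weight i u) = (\<Sum>i\<in>G2. of_bool (i \<in> top u) * (1 / a))"
  proof (rule sum.cong[OF refl])
    fix i assume i: "i \<in> G2"
    show "top_share i u * weight i u = of_bool (i \<in> top u) * (1 / a)"
      using True top_rivals_eq[OF u _ i]
      by (cases "i \<in> top u") (simp_all add: top_share_def weight_def a_def)
  qed
  also have "\<dots> = real (card (G2 \<inter> top u)) / a"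
    by (simp only: sum_distrib_right[symmetric]) simp
  also have "\<dots> = (real K - a) / a"
    using sel1_le[of u] by (simp add: sel2_eq a_def of_nat_diff)
  also have "\<dots> = \<beta> + (1 + \<beta>) / a * (real K / (1 + \<beta>) - a)"
  proof -
    have "(1 + \<beta>) / a * (real K / (1 + \<beta>) - a) = (real K - (1 + \<beta>) * a) / a"
      using \<beta>_pos by (simp add: right_diff_distrib diff_divide_distrib)
    also have "\<dots> = (real K - a) / a - \<beta>"
      using a by (simp add: diff_divide_distrib distrib_right add_divide_distrib)
    finally show ?thesis by simp
  qed
  also have "\<dots> \<le> \<beta> + (1 + \<beta>) / a * \<bar>real K / (1 + \<beta>) - a\<bar>"
    using a \<beta>_pos by (intro add_left_mono mult_left_mono) auto
  also have "\<dots> \<le> \<beta> + (8 / real K) * \<bar>real K / (1 + \<beta>) - a\<bar>"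
  proof (intro add_left_mono mult_right_mono)
    \<comment> \<open>The 8 is \<open>1 + \<beta> \<le> 2\<close> times the 4 in the weight.\<close>
    have "(1 + \<beta>) * real K \<le> 2 * (4 * a)"
      using a \<beta>_le \<beta>_pos by (intro mult_mono) auto
    then show "(1 + \<beta>) / a \<le> 8 / real K"
      using a K_pos by (simp add: divide_simps)
  qed (use a \<beta>_pos in auto)
  finally show ?thesis by (simp add: a_def abs_minus_commute)
next
  case False
  have "top_share i u * weight i u = 0" if i: "i \<in> G2" for i
    using False top_rivals_eq[OF u _ i] by (auto simp: top_share_def weight_def)
  then have "(\<Sum>i\<in>G2. top_share i u * weight i u) = 0" by (intro sum.neutral ballI)
  then show ?thesis using \<beta>_pos by simp
qed

lemma first_choice_frac_eq:
  assumes "\<sigma> \<in> set_pmf prefs" "G \<subseteq> {..<n}"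
  shows "first_choice_frac \<sigma> (A_st n k (est u) \<sigma>) G = real (card (G \<inter> recs u \<sigma>)) / real (card G)"
proof -
  have "\<sigma> i \<noteq> []" if "i \<in> set (ord u)" for i
  proof -
    have "set (\<sigma> i) = {..<p}"
      using prefs_perm[OF assms(1), of i] that by (simp add: permutations_of_setD(1))
    then show ?thesis using p_pos by force
  qed
  then have "recs u \<sigma> = {i. A_st n k (est u) \<sigma> i = Some (hd (\<sigma> i))}"
    unfolding A_st_eq by (intro receivers_eq) auto
  then have "{i \<in> G. A_st n k (est u) \<sigma> i = Some (hd (\<sigma> i))} = G \<inter> recs u \<sigma>" by auto
  then show ?thesis by (simp add: first_choice_frac_def)
qed

text \<open>This is where \<open>first_choices_have_slots\<close> enters: the leader faces untouched
  capacities, so it is a receiver in \<open>G1\<close>, and replacing it by a receiver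
  \<open>i\<close> leaves the denominator unchanged.\<close>

lemma ratio_eq_sum_share:
  assumes u: "generic u" "leading u" and \<sigma>: "\<sigma> \<in> set_pmf prefs"
    and slots: "first_choices_have_slots k L"
  shows "real (card (G2 \<inter> recs u \<sigma>)) / real (card (G1 \<inter> recs u \<sigma>)) = (\<Sum>i\<in>G2. share i (ord u) \<sigma>)"
proof -
  let ?h = "hd (ord u)"
  obtain xs where x: "ord u = ?h # xs" using ord_ne by (metis list.collapse)
  have "\<sigma> ?h \<in> set_pmf L" using \<sigma> hd_ord(1)[of u] by (simp add: set_Pi_pmf PiE_dflt_def)
  then have "0 < k (hd (\<sigma> ?h))" using slots by (simp add: first_choices_have_slots_def)
  then have h: "?h \<in> recs u \<sigma>" by (subst x) simp
  have "share i (ord u) \<sigma> = of_bool (i \<in> recs u \<sigma>) / real (card (G1 \<inter> recs u \<sigma>))" if i: "i \<in> G2" for i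
  proof (cases "i \<in> recs u \<sigma>")
    case True
    have "i \<notin> G1" using i G_Int by auto
    then have "rivals i (ord u) \<inter> recs u \<sigma> = insert i ((G1 \<inter> recs u \<sigma>) - {?h})"
      using True hd_ord_leading[OF u] by (auto simp: rivals_def)
    moreover have "i \<notin> (G1 \<inter> recs u \<sigma>) - {?h}" using \<open>i \<notin> G1\<close> by simp
    moreover have "Suc (card ((G1 \<inter> recs u \<sigma>) - {?h})) = card (G1 \<inter> recs u \<sigma>)"
      using hd_ord_leading(1)[OF u] h by (intro card_Suc_Diff1) auto
    ultimately have "card (rivals i (ord u) \<inter> recs u \<sigma>) = card (G1 \<inter> recs u \<sigma>)"
      by (simp only: card_insert_disjoint finite_Diff finite_Int finite_receivers simp_thms)
    then show ?thesis by (simp add: share_def)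
  qed (simp add: share_def)
  then have "(\<Sum>i\<in>G2. share i (ord u) \<sigma>) = (\<Sum>i\<in>G2. of_bool (i \<in> recs u \<sigma>) / real (card (G1 \<inter> recs u \<sigma>)))"
    by (intro sum.cong) auto
  also have "\<dots> = real (card (G2 \<inter> recs u \<sigma>)) / real (card (G1 \<inter> recs u \<sigma>))"
    by (simp add: sum_divide_distrib[symmetric])
  finally show ?thesis by simp
qed

text \<open>The weight refers to \<open>top_rivals\<close>, which agrees with \<open>sel1\<close>
  only for assigned \<open>i\<close>; an unassigned \<open>i\<close> has share 0 in any
  case.\<close>

lemma mean_share_weight:
  assumes u: "generic u" "leading u" "K \<le> 4 * sel1 u" and i: "i \<in> G2"
  shows "mean_share i u * weight i u = mean_share i u"
proof (cases "i \<in> top u")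
  case True
  then show ?thesis using u top_rivals_eq[OF u(1,2) i] by (simp add: weight_def)
next
  case False
  have "share i (ord u) \<sigma> = 0" if "\<sigma> \<in> set_pmf prefs" for \<sigma>
  proof -
    have "recs u \<sigma> \<subseteq> set (take (\<Sum>l<p. k l) (ord u))"
      using prefs_perm[OF that] p_pos by (intro receivers_subset_take) auto
    then have "recs u \<sigma> \<subseteq> top u" by (simp only: top_def K_eq[symmetric])
    then show ?thesis using False by (auto simp: share_def)
  qed
  then have "mean_share i u = 0"
    unfolding mean_share_def by (intro integral_eq_zero_AE) (simp add: AE_measure_pmf_iff)
  then show ?thesis by simp
qed

lemma prob_not_leading: "(\<integral>u. of_bool (\<not> leading u) \<partial>utils n) = \<beta> ^ K"
proof -
  have m: "Measurable.pred (utils n) (\<lambda>u. \<not> leading u)"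
    using measurable_leading by measurable
  have set: "{u \<in> space (utils n). \<not> leading u} = (\<Pi>\<^sub>E j\<in>{..<n}. if j \<in> G1 then {..\<beta>} else UNIV)"
    using G_less(1) by (auto simp: space_PiM leading_def PiE_def Pi_def not_less split: if_splits)
  have "emeasure (utils n) {u \<in> space (utils n). \<not> leading u}
      = (\<Prod>j<n. emeasure unif01 (if j \<in> G1 then {..\<beta>} else UNIV))"
    unfolding set by (rule unif.emeasure_PiM) auto
  also have "\<dots> = (\<Prod>j<n. if j \<in> G1 then ennreal \<beta> else 1)"
  proof (rule prod.cong[OF refl])
    interpret D: prob_space unif01 by (rule prob_space_unif01)
    fix j
    show "emeasure unif01 (if j \<in> G1 then {..\<beta>} else UNIV) = (if j \<in> G1 then ennreal \<beta> else 1)"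
      using D.emeasure_space_1 measure_unif01_atMost[of \<beta>] \<beta>_pos \<beta>_le
      by (simp add: D.emeasure_eq_measure)
  qed
  also have "\<dots> = ennreal \<beta> ^ card G1"
  proof -
    have "{..<n} \<inter> G1 = G1" using G_less(1) by auto
    then show ?thesis by (simp add: prod.If_cases)
  qed
  finally have em: "emeasure (utils n) {u \<in> space (utils n). \<not> leading u} = ennreal \<beta> ^ K"
    by (simp only: card_G1)
  have "(\<integral>u. of_bool (\<not> leading u) \<partial>utils n) = (\<integral>u. indicat_real {u \<in> space (utils n). \<not> leading u} u \<partial>utils n)"
    by (intro Bochner_Integration.integral_cong) (auto simp: indicator_def)
  also have "\<dots> = measure (utils n) {u \<in> space (utils n). \<not> leading u}"
    using m by (simp add: pred_def)
  also have "\<dots> = \<beta> ^ K"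
    unfolding measure_def em using \<beta>_pos by (simp add: ennreal_power)
  finally show ?thesis .
qed

text \<open>Profiles without a leader in \<open>G1\<close> cost their probability. If
  \<open>4 * sel1 u\<close> is below \<open>K\<close>, then the deviation from
  \<open>K / (1 + \<beta>)\<close>, at least \<open>K / 2\<close>, exceeds \<open>K / 4\<close>, so
  the trivial bound 1 is charged to \<open>4 / K\<close> times the deviation. Hence
  \<open>24 = (4 + 8) * 2\<close>.\<close>

lemma preference_bound:
  assumes slots: "first_choices_have_slots k L"
  shows "preference_metric n G1 G2 \<beta> unif01 L (A_st n k) \<le> \<beta> + \<beta> ^ K + 24 * sqrt (real n) / real K"
proof -
  define F where "F u \<sigma> = (let M = A_st n k (est u) \<sigma>
      in min_max_ratio (first_choice_frac \<sigma> M G1) (first_choice_frac \<sigma> M G2))" for u \<sigma>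
  define dev where "dev u = \<bar>real (sel1 u) - real K / (1 + \<beta>)\<bar>" for u
  have dev: "integrable (utils n) dev" "(\<integral>u. dev u \<partial>utils n) \<le> 2 * sqrt (real n)"
    using sel1_dev unfolding dev_def[abs_def] by auto
  have Fm: "(\<lambda>(u, \<sigma>). F u \<sigma>) \<in> borel_measurable (utils n \<Otimes>\<^sub>M measure_pmf prefs)"
    unfolding F_def A_st_eq by (rule measurable_profile_ord)
  have Fb: "0 \<le> F u \<sigma>" "F u \<sigma> \<le> 1" for u \<sigma>
    unfolding F_def Let_def first_choice_frac_def by (intro min_max_ratio_bounds; simp)+
  have F_int: "integrable (utils n \<Otimes>\<^sub>M measure_pmf prefs) (\<lambda>(u, \<sigma>). F u \<sigma>)"
    by (rule pair.P.integrable_const_bound[where B = 1]) (use Fm Fb in auto)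
  define R where "R u = of_bool (\<not> leading u) + 4 / real K * dev u + (\<Sum>i\<in>G2. mean_share i u * weight i u)" for u
  have w: "0 \<le> weight i u" "weight i u \<le> 1" for i u by (simp_all add: weight_def)
  have ms_int: "integrable (utils n) (\<lambda>u. mean_share i u * weight i u)" for i
  proof (rule utils.integrable_const_bound[where B = 1])
    have "mean_share i \<in> borel_measurable (utils n)"
      unfolding mean_share_def[abs_def] by (rule measurable_ord_fun)
    then show "(\<lambda>u. mean_share i u * weight i u) \<in> borel_measurable (utils n)"
      by (intro borel_measurable_times measurable_weight)
  qed (auto simp: w mean_share_bounds intro!: mult_le_one)
  have ts_int: "integrable (utils n) (\<lambda>u. top_share i u * weight i u)" for i
  proof (rule utils.integrable_const_bound[where B = 1])
    have "top_share i \<in> borel_measurable (utils n)"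
      unfolding top_share_def[abs_def] top_rivals_def top_def by (rule measurable_ord_fun)
    then show "(\<lambda>u. top_share i u * weight i u) \<in> borel_measurable (utils n)"
      by (intro borel_measurable_times measurable_weight)
  qed (auto simp: w top_share_bounds intro!: mult_le_one)
  have nl_int: "integrable (utils n) (\<lambda>u. of_bool (\<not> leading u) :: real)"
  proof (rule utils.integrable_const_bound[where B = 1])
    note [measurable] = measurable_leading
    have "(\<lambda>u. if leading u then 0 else 1 :: real) \<in> borel_measurable (utils n)" by measurable
    then show "(\<lambda>u. of_bool (\<not> leading u) :: real) \<in> borel_measurable (utils n)"
      by (simp add: of_bool_def if_distrib cong: if_cong)
  qed simp
  have R1: "integrable (utils n) (\<lambda>u. of_bool (\<not> leading u) + 4 / real K * dev u)"
    using nl_int dev(1) by simp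
  have R2: "integrable (utils n) (\<lambda>u. \<Sum>i\<in>G2. mean_share i u * weight i u)"
    by (intro Bochner_Integration.integrable_sum ms_int)
  have point: "(\<integral>\<sigma>. F u \<sigma> \<partial>measure_pmf prefs) \<le> R u" if u: "generic u" for u
  proof (cases "leading u \<and> K \<le> 4 * sel1 u")
    case True
    have le: "F u \<sigma> \<le> (\<Sum>i\<in>G2. share i (ord u) \<sigma>)" if "\<sigma> \<in> set_pmf prefs" for \<sigma>
    proof -
      have "F u \<sigma> \<le> (real (card (G2 \<inter> recs u \<sigma>)) / real K) / (real (card (G1 \<inter> recs u \<sigma>)) / real K)"
      proof -
        have "G1 \<subseteq> {..<n}" "G2 \<subseteq> {..<n}" using G_less by auto
        then show ?thesis
          unfolding F_def Let_def
          by (simp only: first_choice_frac_eq[OF that] card_G1 card_G2) (intro min_max_ratio_le_divide; simp)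
      qed
      also have "\<dots> = real (card (G2 \<inter> recs u \<sigma>)) / real (card (G1 \<inter> recs u \<sigma>))"
        using K_pos by simp
      also have "\<dots> = (\<Sum>i\<in>G2. share i (ord u) \<sigma>)"
        using True by (intro ratio_eq_sum_share u that slots) auto
      finally show ?thesis .
    qed
    have "(\<integral>\<sigma>. F u \<sigma> \<partial>measure_pmf prefs) \<le> (\<integral>\<sigma>. (\<Sum>i\<in>G2. share i (ord u) \<sigma>) \<partial>measure_pmf prefs)"
    proof (rule integral_mono_AE)
      show "integrable (measure_pmf prefs) (F u)" using Fb by (intro integrable_pmf_bounded) blast
      show "integrable (measure_pmf prefs) (\<lambda>\<sigma>. \<Sum>i\<in>G2. share i (ord u) \<sigma>)"
        by (intro Bochner_Integration.integrable_sum integrable_share)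
    qed (simp add: AE_measure_pmf_iff le)
    also have "\<dots> = (\<Sum>i\<in>G2. mean_share i u)"
      unfolding mean_share_def by (rule Bochner_Integration.integral_sum) (rule integrable_share)
    also have "\<dots> = (\<Sum>i\<in>G2. mean_share i u * weight i u)"
      using True by (intro sum.cong) (auto simp: mean_share_weight u)
    also have "\<dots> \<le> R u" by (simp add: R_def dev_def)
    finally show ?thesis .
  next
    case False
    have "(\<integral>\<sigma>. F u \<sigma> \<partial>measure_pmf prefs) \<le> (\<integral>\<sigma>. 1 \<partial>measure_pmf prefs)"
      using Fb by (intro integral_mono integrable_pmf_bounded[where B = 1]) auto
    also have "\<dots> \<le> of_bool (\<not> leading u) + 4 / real K * dev u"
    proof (cases "leading u")
      case True
      then have a: "4 * real (sel1 u) \<le> real K" using False by linarith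
      have "real K / 2 \<le> real K / (1 + \<beta>)"
        using \<beta>_pos \<beta>_le by (intro divide_left_mono) auto
      then have "real K / 4 \<le> dev u" using a unfolding dev_def by linarith
      then show ?thesis using K_pos True by (simp add: field_simps)
    qed (simp add: dev_def)
    also have "\<dots> \<le> R u"
      unfolding R_def by (simp add: sum_nonneg w mean_share_bounds)
    finally show ?thesis .
  qed
  have "preference_metric n G1 G2 \<beta> unif01 L (A_st n k)
      = (\<integral>w. (case w of (u, \<sigma>) \<Rightarrow> F u \<sigma>) \<partial>(utils n \<Otimes>\<^sub>M measure_pmf prefs))"
    by (simp add: preference_metric_def profile_eq F_def)
  also have "\<dots> = (\<integral>u. (\<integral>\<sigma>. F u \<sigma> \<partial>measure_pmf prefs) \<partial>utils n)"
    using pair.integral_fst'[OF F_int] by simp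
  also have "\<dots> \<le> (\<integral>u. R u \<partial>utils n)"
  proof (rule integral_mono_AE)
    show "integrable (utils n) (\<lambda>u. \<integral>\<sigma>. F u \<sigma> \<partial>measure_pmf prefs)"
      using pair.integrable_fst'[OF F_int] by simp
    show "integrable (utils n) R"
      unfolding R_def[abs_def] by (rule Bochner_Integration.integrable_add[OF R1 R2])
    show "AE u in utils n. (\<integral>\<sigma>. F u \<sigma> \<partial>measure_pmf prefs) \<le> R u"
      using AE_generic by (rule eventually_mono) (rule point)
  qed
  also have "\<dots> = (\<integral>u. of_bool (\<not> leading u) \<partial>utils n) + 4 / real K * (\<integral>u. dev u \<partial>utils n)
      + (\<Sum>i\<in>G2. \<integral>u. mean_share i u * weight i u \<partial>utils n)"
    unfolding R_def Bochner_Integration.integral_add[OF R1 R2]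
      Bochner_Integration.integral_sum[OF ms_int]
    using nl_int dev(1) by simp
  also have "(\<Sum>i\<in>G2. \<integral>u. mean_share i u * weight i u \<partial>utils n)
      \<le> (\<Sum>i\<in>G2. \<integral>u. top_share i u * weight i u \<partial>utils n)"
    by (intro sum_mono mean_share_le_top_share)
  also have "\<dots> = (\<integral>u. (\<Sum>i\<in>G2. top_share i u * weight i u) \<partial>utils n)"
    by (rule Bochner_Integration.integral_sum[symmetric]) (rule ts_int)
  also have "\<dots> \<le> (\<integral>u. \<beta> + 8 / real K * dev u \<partial>utils n)"
  proof (rule integral_mono_AE)
    show "integrable (utils n) (\<lambda>u. \<Sum>i\<in>G2. top_share i u * weight i u)"
      by (intro Bochner_Integration.integrable_sum ts_int)
    show "integrable (utils n) (\<lambda>u. \<beta> + 8 / real K * dev u)" using dev(1) by simp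
    show "AE u in utils n. (\<Sum>i\<in>G2. top_share i u * weight i u) \<le> \<beta> + 8 / real K * dev u"
      using AE_generic unfolding dev_def by (rule eventually_mono) (rule sum_top_share_le)
  qed
  also have "\<dots> = \<beta> + 8 / real K * (\<integral>u. dev u \<partial>utils n)"
    using dev(1) by (simp add: utils.prob_space)
  finally have "preference_metric n G1 G2 \<beta> unif01 L (A_st n k)
      \<le> \<beta> + \<beta> ^ K + 12 / real K * (\<integral>u. dev u \<partial>utils n)"
    unfolding prob_not_leading by (simp add: field_simps)
  also have "\<dots> \<le> \<beta> + \<beta> ^ K + 12 / real K * (2 * sqrt (real n))"
    using dev(2) by (intro add_left_mono mult_left_mono) auto
  finally show ?thesis by simp
qed

section \<open>Conversion into the stated rates\<close>

lemma preference_metric_le_1: "preference_metric n G1 G2 \<beta> unif01 L (A_st n k) \<le> 1"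
proof -
  have "preference_metric n G1 G2 \<beta> unif01 L (A_st n k)
      \<le> (\<integral>w. 1 \<partial>(utils n \<Otimes>\<^sub>M measure_pmf prefs))"
    unfolding preference_metric_def profile_eq
    by (rule integral_mono') (auto simp: Let_def first_choice_frac_def intro!: min_max_ratio_bounds)
  then show ?thesis by (simp add: pair.P.prob_space)
qed

text \<open>\<open>\<beta> \<le> exp (\<beta> - 1)\<close> and \<open>x \<le> exp x\<close>. It
  serves for \<beta> bounded away from 1 by the target error \<open>e\<close>.\<close>

lemma power_gap_le:
  assumes "0 < e" "e \<le> 1 - \<beta>"
  shows "\<beta> ^ K \<le> 1 / (real K * e)"
proof -
  have "\<beta> \<le> exp (\<beta> - 1)" using exp_ge_add_one_self[of "\<beta> - 1"] by simp
  then have "\<beta> ^ K \<le> exp (\<beta> - 1) ^ K" using \<beta>_pos by (intro power_mono) auto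
  also have "\<dots> = exp (- (real K * (1 - \<beta>)))" by (simp add: exp_of_nat_mult[symmetric] algebra_simps)
  also have "\<dots> \<le> exp (- (real K * e))" using assms by (simp add: mult_left_mono)
  also have "\<dots> = 1 / exp (real K * e)" by (simp add: exp_minus inverse_eq_divide)
  also have "\<dots> \<le> 1 / (real K * e)"
  proof (rule divide_left_mono)
    show "real K * e \<le> exp (real K * e)" using exp_ge_add_one_self[of "real K * e"] by linarith
  qed (use assms K_pos in auto)
  finally show ?thesis .
qed

text \<open>The preference metric dictates the constant: \<open>100 = 4 * 24 + 4\<close>, where the
  last 4 bounds the power of \<beta>.\<close>

lemma metrics_bounds:
  defines "err \<equiv> sqrt (ln (real n)) / sqrt (real n)"
  shows "first_choices_have_slots k L \<Longrightarrow>
      preference_metric n G1 G2 \<beta> unif01 L (A_st n k) \<le> \<beta> + 100 * (real p * err)"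
    and "\<bar>representation_metric n G1 G2 \<beta> unif01 L (A_st n k) - \<beta>\<bar> \<le> 100 * err"
    and "\<bar>utility_metric n K G2 \<beta> unif01 L (A_st n k) - (2 / 3 + 4 * \<beta> / (3 * (\<beta> + 1)\<^sup>2))\<bar> \<le> 100 * err"
proof -
  have n2: "2 \<le> n" using n_eq K_pos by simp
  define s where "s = sqrt (real n)"
  define l where "l = sqrt (ln (real n))"
  have s: "0 < s" "s * s = real n" using n2 by (simp_all add: s_def)
  have "1 / 2 \<le> ln (2 :: real)" using ln2_ge_two_thirds by simp
  also have "\<dots> \<le> ln (real n)" using n2 by simp
  finally have ln: "1 / 2 \<le> ln (real n)" .
  have l2: "l * l = ln (real n)" using ln by (simp add: l_def)
  have "sqrt (1 / 4) \<le> l" unfolding l_def using ln by (intro real_sqrt_le_mono) simp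
  then have l: "1 / 2 \<le> l" by (simp add: real_sqrt_divide)
  have err: "err = l / s" by (simp add: err_def l_def s_def)
  have Kn: "real K = s * s / 2" using s n_eq by simp
  have rate: "c * s / real K \<le> 4 * c * err" if "0 \<le> c" for c
  proof -
    have "c * s / real K = 2 * c / s" using s(1) by (simp add: Kn field_simps)
    also have "\<dots> \<le> (4 * l) * c / s"
      using s l that by (intro divide_right_mono mult_right_mono) auto
    finally show ?thesis by (simp add: err mult_ac)
  qed
  have err_pos: "0 < err" using l s by (simp add: err)
  show "\<bar>representation_metric n G1 G2 \<beta> unif01 L (A_st n k) - \<beta>\<bar> \<le> 100 * err"
    using representation_bound rate[of 8] err_pos unfolding s_def by linarith
  show "\<bar>utility_metric n K G2 \<beta> unif01 L (A_st n k) - (2 / 3 + 4 * \<beta> / (3 * (\<beta> + 1)\<^sup>2))\<bar> \<le> 100 * err"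
    using utility_bound rate[of "16 / 3"] err_pos unfolding s_def by simp
  assume slots: "first_choices_have_slots k L"
  have "preference_metric n G1 G2 \<beta> unif01 L (A_st n k) \<le> \<beta> + 100 * err"
  \<comment> \<open>If \<beta> is within \<open>err\<close> of 1, then the bound 1 on the metric is
    already good enough.\<close>
  proof (cases "err \<le> 1 - \<beta>")
    case True
    have "\<beta> ^ K \<le> 1 / (real K * err)" by (rule power_gap_le[OF err_pos True])
    also have "\<dots> = 2 / (s * l)" using s(1) l by (simp add: Kn err field_simps)
    also have "\<dots> = 2 / (l * l) * err" using s l by (simp add: err)
    also have "\<dots> \<le> 4 * err"
      using ln err_pos by (intro mult_right_mono) (auto simp: l2 divide_simps)
    finally have "\<beta> ^ K \<le> 4 * err" .
    then show ?thesis
      using preference_bound[OF slots] rate[of 24] err_pos unfolding s_def by linarith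
  next
    case False
    then show ?thesis using preference_metric_le_1 err_pos by linarith
  qed
  also have "\<dots> \<le> \<beta> + 100 * (real p * err)"
    using p_pos err_pos by simp
  finally show "preference_metric n G1 G2 \<beta> unif01 L (A_st n k) \<le> \<beta> + 100 * (real p * err)" .
qed

end

theorem theorem1:
  shows "\<exists>C::real. 0 < C \<and>
    (\<forall>(n::nat) (K::nat) (p::nat) (k :: nat \<Rightarrow> nat) (G1 :: nat set) (G2 :: nat set)
       (L :: nat list pmf) (\<beta>::real).
      K = (\<Sum>l<p. k l) \<longrightarrow> 1 \<le> K \<longrightarrow>
      G1 \<union> G2 = {..<n} \<longrightarrow> G1 \<inter> G2 = {} \<longrightarrow> card G1 = K \<longrightarrow> card G2 = K \<longrightarrow>
      set_pmf L \<subseteq> permutations_of_set {..<p} \<longrightarrow>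
      0 < \<beta> \<longrightarrow> \<beta> \<le> 1 \<longrightarrow>
      (let D = uniform_measure lborel {0..1::real};
           err = sqrt (ln (real n)) / sqrt (real n)
       in (first_choices_have_slots k L \<longrightarrow>
             preference_metric n G1 G2 \<beta> D L (A_st n k) \<le> \<beta> + C * (real p * err)) \<and>
          \<bar>representation_metric n G1 G2 \<beta> D L (A_st n k) - \<beta>\<bar> \<le> C * err \<and>
          \<bar>utility_metric n K G2 \<beta> D L (A_st n k) - (2 / 3 + 4 * \<beta> / (3 * (\<beta> + 1)\<^sup>2))\<bar>
            \<le> C * err))"
proof (intro exI[of _ 100] conjI allI impI)
  fix n K p :: nat and k :: "nat \<Rightarrow> nat" and G1 G2 :: "nat set" and L :: "nat list pmf" and \<beta> :: real
  assume "K = (\<Sum>l<p. k l)" "1 \<le> K" "G1 \<union> G2 = {..<n}" "G1 \<inter> G2 = {}" "card G1 = K" "card G2 = K"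
    "set_pmf L \<subseteq> permutations_of_set {..<p}" "0 < \<beta>" "\<beta> \<le> 1"
  then interpret selection n K p k G1 G2 L \<beta>
    by unfold_locales
  show "let D = uniform_measure lborel {0..1::real};
           err = sqrt (ln (real n)) / sqrt (real n)
       in (first_choices_have_slots k L \<longrightarrow>
             preference_metric n G1 G2 \<beta> D L (A_st n k) \<le> \<beta> + 100 * (real p * err)) \<and>
          \<bar>representation_metric n G1 G2 \<beta> D L (A_st n k) - \<beta>\<bar> \<le> 100 * err \<and>
          \<bar>utility_metric n K G2 \<beta> D L (A_st n k) - (2 / 3 + 4 * \<beta> / (3 * (\<beta> + 1)\<^sup>2))\<bar>
            \<le> 100 * err"
    unfolding Let_def unif01_def[symmetric] using metrics_bounds by blast
qed simp

end
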